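(* Let $\mathcal T\in\mathrm{Tree}(N)$. Let $(\mathcal H_1,\xi_1),\dots,(\mathcal H_N,\xi_N)$ be $\mathcal B$-$\mathcal B$-correspondences with $\mathcal B$-central unit vectors, let $(\mathcal H,\xi)$ be their $\mathcal T$-free product, and let $\lambda_j=\lambda_{\mathcal T,j}:\mathcal L(\mathcal H_j)\to\mathcal L(\mathcal H)$ be the corresponding $*$-homomorphisms. Let $\chi:[\ell]\to[N]$ be a coloring and let $a_j\in\mathcal L(\mathcal H_{\chi(j)})$ for $j=1,\dots,\ell$. Then \[ \langle \xi,\lambda_{\chi(1)}(a_1)\cdots\lambda_{\chi(\ell)}(a_\ell)\,\xi\rangle=\sum_{\pi\in\mathcal{NC}(\chi,\mathcal T)}\Lambda_{\chi,\pi}[a_1,\dots,a_\ell], \] where the maps $\Lambda_{\chi,\pi}:\mathcal L(\mathcal H_{\chi(1)})\times\cdots\times\mathcal L(\mathcal H_{\chi(\ell)})\to\mathcal B$ are defined recursively by: $\Lambda=1$ for the empty partition of the empty set; and if $V=\{j+1,\dots,k\}$ is an interval block of $\pi$, then \[ \Lambda_{\chi,\pi}[a_1,\dots,a_\ell]=\Lambda_{\chi|_{[\ell]\setminus V},\,\pi\setminus V}\bigl[a_1,\dots,a_j,\;K_{\mathrm{Bool},k-j}[a_{j+1},\dots,a_k]\,a_{k+1},\dots,a_\ell\bigr]\quad\text{if }k<\ell, \] \[ \Lambda_{\chi,\pi}[a_1,\dots,a_\ell]=\Lambda_{\chi|_{[\ell]\setminus V},\,\pi\setminus V}[a_1,\dots,a_j]\;K_{\mathrm{Bool},k-j}[a_{j+1},\dots,a_k]\quad\text{if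 }k=\ell, \] where $K_{\mathrm{Bool},k-j}:\mathcal L(\mathcal H_{\chi(V)})^{k-j}\to\mathcal B$ is the Boolean cumulant of $\mathcal L(\mathcal H_{\chi(V)})$ with respect to the expectation $a\mapsto\langle\xi_{\chi(V)},a\,\xi_{\chi(V)}\rangle$, and $\chi(V)$ is the constant value of $\chi$ on $V$. (Here $[\ell]\setminus V$ is identified with $[\ell-(k-j)]$ by the order-preserving bijection.)
   Context: $\mathcal B$ is a unital $C^*$-algebra. For a right Hilbert $\mathcal B$-module $\mathcal H$ (inner product right $\mathcal B$-linear in the second variable), $\mathcal L(\mathcal H)$ is the $C^*$-algebra of bounded adjointable right-$\mathcal B$-modular operators. A $\mathcal B$-$\mathcal B$-correspondence is a right Hilbert $\mathcal B$-module $\mathcal H$ with a left action given by a unital $*$-homomorphism $\mathcal B\to\mathcal L(\mathcal H)$. A $\mathcal B$-central unit vector is $\xi\in\mathcal H$ with $\langle\xi,\xi\rangle=1$ and $b\xi=\xi b$ for all $b\in\mathcal B$; then $\mathcal H=\mathcal B\xi\oplus\mathcal H^\circ$ with $\mathcal H^\circ=\{h:\langle h,\xi\rangle=0\}$, and $\mathcal B$ embeds in $\mathcal L(\mathcal H)$ by left multiplication. $\otimes_{\mathcal B}$ is the tensor product of correspondences, with inner product $\langle h_1\otimes h_2,h_1'\otimes h_2'\rangle=\langle h_2,\langle h_1,h_1'\rangle h_2'\rangle$. Trees: $[N]=\{1,\dots,N\}$. A string on $[N]$ is a finite sequence of letters in $[N]$ (the empty string is $\emptyset$); $s(1)$ is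 its first letter; it is alternating if consecutive letters differ. $\mathcal T_{N,\mathrm{free}}$ is the graph whose vertices are the alternating strings on $[N]$, with an edge between $s$ and $js$ whenever $js$ is alternating, rooted at $\emptyset$. $\mathrm{Tree}(N)$ is the set of connected subgraphs containing $\emptyset$; each is identified with its vertex set. $\mathcal T$-free product: $\mathcal H=\bigoplus_{s\in\mathcal T}\mathcal H_s^\circ$ where $\mathcal H_\emptyset^\circ=\mathcal B$, $\mathcal H^\circ_{j_1\cdots j_m}=\mathcal H_{j_1}^\circ\otimes_{\mathcal B}\cdots\otimes_{\mathcal B}\mathcal H_{j_m}^\circ$, and $\xi=1\in\mathcal H_\emptyset^\circ$. The (not necessarily unital) $*$-homomorphism $\lambda_{\mathcal T,j}$ is given as follows: for $s\in\mathcal T$ not beginning with $j$ and with $js\in\mathcal T$, $\lambda_{\mathcal T,j}(x)$ acts on $\mathcal H_s^\circ\oplus\mathcal H_{js}^\circ\cong\mathcal H_j\otimes_{\mathcal B}\mathcal H_s^\circ$ as $x\otimes\mathrm{id}$; for $s\in\mathcal T$ not beginning with $j$ and with $js\notin\mathcal T$, it is zero on $\mathcal H_s^\circ$. Partitions: $\mathcal{NC}(S)$ is the set of non-crossing partitions of a finite totally ordered set $S$ (for $S=\varnothing$ there is exactly one, with no blocks). A block $V$ is nested inside a block $W$, written $W\prec V$, if there are $j,k\in W$ with $j<v<k$ for all $v\in V$. For a block $V$, $\mathrm{chain}(V)=(V,V_1,\dots,V_d)$ where $V\succ V_1\succ\cdots\succ V_d$ are all the blocks in which $V$ is nested. An interval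 block is one consisting of consecutive elements of $S$. For $\chi:[\ell]\to[N]$, $\mathcal{NC}(\chi,\mathcal T)$ is the set of $\pi\in\mathcal{NC}([\ell])$ such that $\chi$ is constant on each block and for every block $V$ with $\mathrm{chain}(V)=(V,V_1,\dots,V_d)$ the string $\chi(V)\chi(V_1)\cdots\chi(V_d)$ is in $\mathcal T$. $\pi\setminus V$ denotes $\pi$ with the block $V$ deleted. Boolean cumulants: for $E:\mathcal A\to\mathcal B$, the maps $K_{\mathrm{Bool},m}:\mathcal A^m\to\mathcal B$ are determined by $E[a_1\cdots a_m]=\sum_{\pi}\prod_{V\in\pi}K_{\mathrm{Bool},|V|}[a_i:i\in V]$, the sum being over partitions $\pi$ of $[m]$ all of whose blocks are intervals, with blocks multiplied from left to right and the arguments inside each block in increasing order. *)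

theory Defs
  imports Complex_Main "HOL-Library.Disjoint_Sets"
begin

section \<open>Unital $C^*$-algebras\<close>

text \<open>
  The unit is added through \<^class>\<open>monoid_mult\<close> rather than \<^class>\<open>ring_1\<close>, so the zero algebra is
  not excluded.
\<close>

class unital_cstar_algebra = real_normed_algebra + banach + monoid_mult +
  fixes scaleC :: "complex \<Rightarrow> 'a \<Rightarrow> 'a"
    and star :: "'a \<Rightarrow> 'a"
  assumes scaleC_of_real: "scaleC (of_real r) x = r *\<^sub>R x"
    and scaleC_add_right: "scaleC c (x + y) = scaleC c x + scaleC c y"
    and scaleC_add_left: "scaleC (c + d) x = scaleC c x + scaleC d x"
    and scaleC_scaleC: "scaleC c (scaleC d x) = scaleC (c * d) x"
    and norm_scaleC: "norm (scaleC c x) = cmod c * norm x"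
    and mult_scaleC_left: "scaleC c x * y = scaleC c (x * y)"
    and mult_scaleC_right: "x * scaleC c y = scaleC c (x * y)"
    and star_star: "star (star x) = x"
    and star_add: "star (x + y) = star x + star y"
    and star_scaleC: "star (scaleC c x) = scaleC (cnj c) (star x)"
    and star_mult: "star (x * y) = star y * star x"
    and cstar_identity: "norm (star x * x) = (norm x)\<^sup>2"

definition cstar_positive :: "'b::unital_cstar_algebra \<Rightarrow> bool" where
  "cstar_positive b \<longleftrightarrow> (\<exists>c. b = star c * c)"

instantiation complex :: unital_cstar_algebra
begin
definition scaleC_complex :: "complex \<Rightarrow> complex \<Rightarrow> complex" where "scaleC_complex = (*)"
definition star_complex :: "complex \<Rightarrow> complex" where "star_complex = cnj"
instance
  by standard
    (simp_all add: scaleC_complex_def star_complex_def scaleR_conv_of_real algebra_simps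
       norm_mult power2_eq_square)
end


section \<open>Hilbert modules and correspondences\<close>

text \<open>
  Modules live on a carrier set, an additive subgroup of an ambient abelian group type, so that a
  family of different modules can share one type. No separate complex scalar multiplication is
  needed: as the algebra is unital, $c h$ is $h (c 1)$.
\<close>

record ('b, 'h) hmod =
  carr :: "'h set"
  ract :: "'h \<Rightarrow> 'b \<Rightarrow> 'h"
  ip :: "'h \<Rightarrow> 'h \<Rightarrow> 'b"

record ('b, 'h) corr = "('b, 'h) hmod" +
  lact :: "'b \<Rightarrow> 'h \<Rightarrow> 'h"

definition hnorm :: "('b::unital_cstar_algebra, 'h, 'm) hmod_scheme \<Rightarrow> 'h \<Rightarrow> real" where
  "hnorm H x = sqrt (norm (ip H x x))"

locale hilbert_module =
  fixes H :: "('b::unital_cstar_algebra, 'h::ab_group_add, 'm) hmod_scheme"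
  assumes zero_closed: "0 \<in> carr H"
    and add_closed: "\<lbrakk>x \<in> carr H; y \<in> carr H\<rbrakk> \<Longrightarrow> x + y \<in> carr H"
    and uminus_closed: "x \<in> carr H \<Longrightarrow> - x \<in> carr H"
    and ract_closed: "x \<in> carr H \<Longrightarrow> ract H x b \<in> carr H"
    and ract_add_left: "\<lbrakk>x \<in> carr H; y \<in> carr H\<rbrakk> \<Longrightarrow> ract H (x + y) b = ract H x b + ract H y b"
    and ract_add_right: "x \<in> carr H \<Longrightarrow> ract H x (b + c) = ract H x b + ract H x c"
    and ract_mult: "x \<in> carr H \<Longrightarrow> ract H x (b * c) = ract H (ract H x b) c"
    and ract_one: "x \<in> carr H \<Longrightarrow> ract H x 1 = x"
    and ip_add_right:
      "\<lbrakk>x \<in> carr H; y \<in> carr H; z \<in> carr H\<rbrakk> \<Longrightarrow> ip H x (y + z) = ip H x y + ip H x z"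
    and ip_ract_right: "\<lbrakk>x \<in> carr H; y \<in> carr H\<rbrakk> \<Longrightarrow> ip H x (ract H y b) = ip H x y * b"
    and ip_star: "\<lbrakk>x \<in> carr H; y \<in> carr H\<rbrakk> \<Longrightarrow> ip H y x = star (ip H x y)"
    and ip_positive: "x \<in> carr H \<Longrightarrow> cstar_positive (ip H x x)"
    and ip_definite: "\<lbrakk>x \<in> carr H; ip H x x = 0\<rbrakk> \<Longrightarrow> x = 0"
    and complete:
      "\<lbrakk>\<And>n. f n \<in> carr H; \<And>e. e > 0 \<Longrightarrow> \<exists>M. \<forall>m\<ge>M. \<forall>n\<ge>M. hnorm H (f m - f n) < e\<rbrakk>
       \<Longrightarrow> \<exists>x\<in>carr H. (\<lambda>n. hnorm H (f n - x)) \<longlonglongrightarrow> 0"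

text \<open>
  $\mathcal L(\mathcal H)$. Only the values on the carrier matter: an operator may be represented by
  several functions. The product of operators is composition of functions.
\<close>

definition adjointable :: "('b::unital_cstar_algebra, 'h::ab_group_add, 'm) hmod_scheme \<Rightarrow> ('h \<Rightarrow> 'h) set"
  where "adjointable H = {a.
    (\<forall>x\<in>carr H. a x \<in> carr H) \<and>
    (\<forall>x\<in>carr H. \<forall>y\<in>carr H. a (x + y) = a x + a y) \<and>
    (\<forall>x\<in>carr H. \<forall>b. a (ract H x b) = ract H (a x) b) \<and>
    (\<exists>C. \<forall>x\<in>carr H. hnorm H (a x) \<le> C * hnorm H x) \<and>
    (\<exists>a'. \<forall>x\<in>carr H. a' x \<in> carr H \<and> (\<forall>y\<in>carr H. ip H (a' x) y = ip H x (a y)))}"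

locale correspondence = hilbert_module H
  for H :: "('b::unital_cstar_algebra, 'h::ab_group_add, 'm) corr_scheme" +
  assumes lact_adjointable: "lact H b \<in> adjointable H"
    and lact_add: "x \<in> carr H \<Longrightarrow> lact H (b + c) x = lact H b x + lact H c x"
    and lact_scaleC: "x \<in> carr H \<Longrightarrow> lact H (scaleC z b) x = ract H (lact H b x) (scaleC z 1)"
    and lact_mult: "x \<in> carr H \<Longrightarrow> lact H (b * c) x = lact H b (lact H c x)"
    and lact_one: "x \<in> carr H \<Longrightarrow> lact H 1 x = x"
    and lact_star: "\<lbrakk>x \<in> carr H; y \<in> carr H\<rbrakk> \<Longrightarrow> ip H (lact H b x) y = ip H x (lact H (star b) y)"

definition central_unit_vector ::
    "('b::unital_cstar_algebra, 'h::ab_group_add, 'm) corr_scheme \<Rightarrow> 'h \<Rightarrow> bool" where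
  "central_unit_vector H \<xi> \<longleftrightarrow>
     \<xi> \<in> carr H \<and> ip H \<xi> \<xi> = 1 \<and> (\<forall>b. lact H b \<xi> = ract H \<xi> b)"

definition centered :: "('b::unital_cstar_algebra, 'h::ab_group_add) corr \<Rightarrow> 'h \<Rightarrow> ('b, 'h) corr" where
  "centered H \<xi> = H\<lparr>carr := {h \<in> carr H. ip H h \<xi> = 0}\<rparr>"

text \<open>
  \<open>interior_tensor X Y Z \<tau>\<close>: the correspondence \<open>Z\<close>, together with the map
  $\tau(x, y) = x \otimes y$, is (a realization of) $X \otimes_{\mathcal B} Y$. The tensor product
  is the completion of the algebraic balanced tensor product, modulo null vectors, for the inner
  product \<open>tensor_ip\<close>; the conditions below determine \<open>Z\<close> and \<open>\<tau>\<close> up to a unique unitary isomorphism.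
  Complex multiples in the linear span are absorbed into the right action.
\<close>

locale interior_tensor =
  X: correspondence X + Y: correspondence Y + Z: correspondence Z
  for X :: "('b::unital_cstar_algebra, 'x::ab_group_add) corr"
    and Y :: "('b, 'y::ab_group_add) corr"
    and Z :: "('b, 'z::ab_group_add) corr"
    and \<tau> :: "'x \<Rightarrow> 'y \<Rightarrow> 'z" +
  assumes tensor_closed: "\<lbrakk>x \<in> carr X; y \<in> carr Y\<rbrakk> \<Longrightarrow> \<tau> x y \<in> carr Z"
    and tensor_add_left:
      "\<lbrakk>x \<in> carr X; x' \<in> carr X; y \<in> carr Y\<rbrakk> \<Longrightarrow> \<tau> (x + x') y = \<tau> x y + \<tau> x' y"
    and tensor_add_right:
      "\<lbrakk>x \<in> carr X; y \<in> carr Y; y' \<in> carr Y\<rbrakk> \<Longrightarrow> \<tau> x (y + y') = \<tau> x y + \<tau> x y'"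
    and tensor_balanced: "\<lbrakk>x \<in> carr X; y \<in> carr Y\<rbrakk> \<Longrightarrow> \<tau> (ract X x b) y = \<tau> x (lact Y b y)"
    and tensor_ract: "\<lbrakk>x \<in> carr X; y \<in> carr Y\<rbrakk> \<Longrightarrow> ract Z (\<tau> x y) b = \<tau> x (ract Y y b)"
    and tensor_lact: "\<lbrakk>x \<in> carr X; y \<in> carr Y\<rbrakk> \<Longrightarrow> lact Z b (\<tau> x y) = \<tau> (lact X b x) y"
    and tensor_ip: "\<lbrakk>x \<in> carr X; x' \<in> carr X; y \<in> carr Y; y' \<in> carr Y\<rbrakk>
      \<Longrightarrow> ip Z (\<tau> x y) (\<tau> x' y') = ip Y y (lact Y (ip X x x') y')"
    and tensor_dense: "\<lbrakk>z \<in> carr Z; e > 0\<rbrakk> \<Longrightarrow>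
      \<exists>(n::nat) x y. (\<forall>i<n. x i \<in> carr X \<and> y i \<in> carr Y) \<and> hnorm Z (z - (\<Sum>i<n. \<tau> (x i) (y i))) < e"

text \<open>\<open>H\<close> is the (completed, internal) orthogonal direct sum of the subspaces \<open>W s\<close> for \<open>s \<in> I\<close>.\<close>

locale orthogonal_direct_sum = correspondence H
  for H :: "('b::unital_cstar_algebra, 'k::ab_group_add) corr" and I :: "'i set" and W :: "'i \<Rightarrow> 'k set" +
  assumes summand_subset: "s \<in> I \<Longrightarrow> W s \<subseteq> carr H"
    and summand_corr: "s \<in> I \<Longrightarrow> correspondence (H\<lparr>carr := W s\<rparr>)"
    and summand_orthogonal: "\<lbrakk>s \<in> I; t \<in> I; s \<noteq> t; x \<in> W s; y \<in> W t\<rbrakk> \<Longrightarrow> ip H x y = 0"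
    and summand_dense: "\<lbrakk>x \<in> carr H; e > 0\<rbrakk> \<Longrightarrow>
      \<exists>F w. finite F \<and> F \<subseteq> I \<and> (\<forall>s\<in>F. w s \<in> W s) \<and> hnorm H (x - (\<Sum>s\<in>F. w s)) < e"


section \<open>Trees and the free product over a tree\<close>

text \<open>Strings are lists with the first letter at the head.\<close>

definition free_tree_vertices :: "nat \<Rightarrow> nat list set" where
  "free_tree_vertices N = {s. set s \<subseteq> {1..N} \<and> distinct_adj s}"

definition free_tree_edges :: "nat \<Rightarrow> nat list set set" where
  "free_tree_edges N =
     {{s, j # s} | s j. s \<in> free_tree_vertices N \<and> j # s \<in> free_tree_vertices N}"

definition Tree :: "nat \<Rightarrow> nat list set set" where
  "Tree N = {T. T \<subseteq> free_tree_vertices N \<and> [] \<in> T \<and>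
     (\<exists>E\<subseteq>free_tree_edges N. (\<forall>e\<in>E. e \<subseteq> T) \<and>
        (\<forall>s\<in>T. \<forall>t\<in>T. (s, t) \<in> {(u, v). {u, v} \<in> E}\<^sup>*))}"

text \<open>
  \<open>H\<close>, with vacuum vector \<open>\<xi>\<close>, is the \<open>T\<close>-free product of the correspondences \<open>Hs j\<close> with central unit
  vectors \<open>\<xi>s j\<close>. The summand $\mathcal H_s^\circ$ is \<open>W s\<close>. The summand for the empty string is a copy of
  the algebra, an element $b$ corresponding to $\xi b$, and
  $\mathcal H_{js}^\circ = \mathcal H_j^\circ \otimes \mathcal H_s^\circ$ with $h \otimes w$ given by
  \<open>\<tau> j s h w\<close>. Like the tensor product, the free product is pinned down up to a unique
  isomorphism rather than as one particular set. (For a single letter this is $\mathcal H_j^\circ \otimes \mathcal B \cong \mathcal H_j^\circ$.)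
\<close>

locale T_free_product = orthogonal_direct_sum H T W
  for T :: "nat list set"
    and Hs :: "nat \<Rightarrow> ('b::unital_cstar_algebra, 'h::ab_group_add) corr"
    and \<xi>s :: "nat \<Rightarrow> 'h"
    and H :: "('b, 'k::ab_group_add) corr"
    and \<xi> :: 'k
    and W :: "nat list \<Rightarrow> 'k set"
    and \<tau> :: "nat \<Rightarrow> nat list \<Rightarrow> 'h \<Rightarrow> 'k \<Rightarrow> 'k" +
  assumes vacuum: "central_unit_vector H \<xi>"
    and summand_Nil: "W [] = range (ract H \<xi>)"
    and summand_Cons: "j # s \<in> T \<Longrightarrow>
      interior_tensor (centered (Hs j) (\<xi>s j)) (H\<lparr>carr := W s\<rparr>) (H\<lparr>carr := W (j # s)\<rparr>) (\<tau> j s)"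

text \<open>
  The isomorphism $\mathcal H_j \otimes_{\mathcal B} \mathcal H_s^\circ \cong
  \mathcal H_s^\circ \oplus \mathcal H_{js}^\circ$ on $h \otimes w$: write
  $h = \xi_j \langle \xi_j, h \rangle + h^\circ$ and use $\xi_j b \otimes w \mapsto b w$.
\<close>

definition tensor_split ::
    "('b::unital_cstar_algebra, 'h::ab_group_add) corr \<Rightarrow> 'h \<Rightarrow> ('b, 'k::ab_group_add) corr
      \<Rightarrow> ('h \<Rightarrow> 'k \<Rightarrow> 'k) \<Rightarrow> 'h \<Rightarrow> 'k \<Rightarrow> 'k" where
  "tensor_split Hj \<xi>j H t h w =
     lact H (ip Hj \<xi>j h) w + t (h - ract Hj \<xi>j (ip Hj \<xi>j h)) w"

text \<open>
  \<open>is_lambda T Hs \<xi>s H W \<tau> j x L\<close>: the operator \<open>L\<close> on the \<open>T\<close>-free product \<open>H\<close> is $\lambda_{T,j}(x)$.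
  The vectors on which \<open>L\<close> is prescribed have dense span, so \<open>L\<close> is determined by this (on the carrier);
  in particular multiplicativity, linearity and compatibility with adjoints in \<open>x\<close> follow.
\<close>

definition is_lambda ::
    "nat list set \<Rightarrow> (nat \<Rightarrow> ('b::unital_cstar_algebra, 'h::ab_group_add) corr) \<Rightarrow> (nat \<Rightarrow> 'h)
      \<Rightarrow> ('b, 'k::ab_group_add) corr \<Rightarrow> (nat list \<Rightarrow> 'k set) \<Rightarrow> (nat \<Rightarrow> nat list \<Rightarrow> 'h \<Rightarrow> 'k \<Rightarrow> 'k)
      \<Rightarrow> nat \<Rightarrow> ('h \<Rightarrow> 'h) \<Rightarrow> ('k \<Rightarrow> 'k) \<Rightarrow> bool" where
  "is_lambda T Hs \<xi>s H W \<tau> j x L \<longleftrightarrow>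
     L \<in> adjointable H \<and>
     (\<forall>s\<in>T. (s = [] \<or> hd s \<noteq> j) \<longrightarrow>
        (if j # s \<in> T
         then \<forall>h\<in>carr (Hs j). \<forall>w\<in>W s.
                L (tensor_split (Hs j) (\<xi>s j) H (\<tau> j s) h w)
                  = tensor_split (Hs j) (\<xi>s j) H (\<tau> j s) (x h) w
         else \<forall>w\<in>W s. L w = 0))"


section \<open>Non-crossing partitions\<close>

definition noncrossing_partitions :: "'i::linorder set \<Rightarrow> 'i set set set" where
  "noncrossing_partitions S = {\<pi>. partition_on S \<pi> \<and>
     \<not> (\<exists>V\<in>\<pi>. \<exists>W\<in>\<pi>. V \<noteq> W \<and> (\<exists>a b c d. a < b \<and> b < c \<and> c < d \<and> a \<in> V \<and> b \<in> W \<and> c \<in> V \<and> d \<in> W))}"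

text \<open>\<open>nested_in V W\<close> is $W \prec V$: the block \<open>V\<close> is nested inside \<open>W\<close>.\<close>

definition nested_in :: "'i::linorder set \<Rightarrow> 'i set \<Rightarrow> bool" where
  "nested_in V W \<longleftrightarrow> (\<exists>j\<in>W. \<exists>k\<in>W. \<forall>v\<in>V. j < v \<and> v < k)"

definition chain :: "'i::linorder set set \<Rightarrow> 'i set \<Rightarrow> 'i set list" where
  "chain \<pi> V = (THE Vs. set Vs = insert V {W \<in> \<pi>. nested_in V W} \<and> sorted_wrt nested_in Vs)"

definition block_color :: "('i \<Rightarrow> 'c) \<Rightarrow> 'i set \<Rightarrow> 'c" where
  "block_color col V = the_elem (col ` V)"

definition NC :: "nat \<Rightarrow> (nat \<Rightarrow> nat) \<Rightarrow> nat list set \<Rightarrow> nat set set set" where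
  "NC l col T = {\<pi> \<in> noncrossing_partitions {1..l}.
     (\<forall>V\<in>\<pi>. \<forall>i\<in>V. \<forall>j\<in>V. col i = col j) \<and>
     (\<forall>V\<in>\<pi>. map (block_color col) (chain \<pi> V) \<in> T)}"

definition interval_block :: "'i::linorder set set \<Rightarrow> 'i set \<Rightarrow> bool" where
  "interval_block \<pi> V \<longleftrightarrow> V \<in> \<pi> \<and> (\<forall>i\<in>V. \<forall>k\<in>V. \<forall>s\<in>\<Union>\<pi>. i < s \<and> s < k \<longrightarrow> s \<in> V)"


section \<open>Boolean cumulants\<close>

text \<open>
  A partition of $[m]$ into intervals is encoded by cutting the argument list $(a_1, \dots, a_m)$ into
  consecutive nonempty segments.
\<close>

definition segmentations :: "'a list \<Rightarrow> 'a list list set" where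
  "segmentations as = {ps. concat ps = as \<and> [] \<notin> set ps}"

lemma length_le_concat: "p \<in> set ps \<Longrightarrow> length p \<le> length (concat ps)"
  by (induction ps) auto

lemma length_concat_nonempty: "[] \<notin> set ps \<Longrightarrow> length ps \<le> length (concat ps)"
  by (induction ps) (auto simp: Suc_le_eq add_strict_increasing)

lemma finite_segmentations: "finite (segmentations as)"
proof -
  have "segmentations as
      \<subseteq> {ps. set ps \<subseteq> {p. set p \<subseteq> set as \<and> length p \<le> length as} \<and> length ps \<le> length as}"
    using length_le_concat length_concat_nonempty by (force simp: segmentations_def)
  then show ?thesis
    by (rule finite_subset) (intro finite_lists_length_le finite_set)
qed

lemma segmentation_smaller:
  assumes "ps \<in> segmentations as" "ps \<noteq> [as]" "p \<in> set ps"
  shows "length p < length as"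
proof -
  from assms(3) obtain qs rs where ps: "ps = qs @ p # rs" by (meson split_list)
  then have "qs \<noteq> [] \<or> rs \<noteq> []"
    using assms(1,2) by (auto simp: segmentations_def)
  moreover have "xs \<noteq> [] \<Longrightarrow> [] \<notin> set xs \<Longrightarrow> length (concat xs) > 0" for xs :: "'a list list"
    by (cases xs) auto
  ultimately show ?thesis
    using assms(1) ps by (fastforce simp: segmentations_def)
qed

text \<open>
  The moment-cumulant formula solved for the term of the one-block partition; see
  \<open>boolean_moment_cumulant\<close> and \<open>bool_cumulant_unique\<close>. The value at the empty list is irrelevant.
  The product $a_1 \cdots a_m$ is \<^term>\<open>foldr (\<circ>) as id\<close>.
\<close>

function bool_cumulant :: "(('h \<Rightarrow> 'h) \<Rightarrow> 'b::unital_cstar_algebra) \<Rightarrow> ('h \<Rightarrow> 'h) list \<Rightarrow> 'b" where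
  "bool_cumulant E as =
     E (foldr (\<circ>) as id)
       - (\<Sum>ps \<in> segmentations as - {[as]}. prod_list (map (bool_cumulant E) ps))"
  by pat_completeness auto
termination
  by (relation "measure (\<lambda>(E, as). length as)") (auto dest: segmentation_smaller)

declare bool_cumulant.simps [simp del]

lemma boolean_moment_cumulant:
  assumes "as \<noteq> []"
  shows "E (foldr (\<circ>) as id) = (\<Sum>ps \<in> segmentations as. prod_list (map (bool_cumulant E) ps))"
proof -
  have "[as] \<in> segmentations as"
    using assms by (simp add: segmentations_def)
  then show ?thesis
    by (subst sum.remove[OF finite_segmentations], assumption)
       (simp add: bool_cumulant.simps[of E as])
qed

lemma bool_cumulant_unique:
  assumes K: "\<And>as. as \<noteq> [] \<Longrightarrow>
    E (foldr (\<circ>) as id) = (\<Sum>ps \<in> segmentations as. prod_list (map K ps))"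
    and "as \<noteq> []"
  shows "K as = bool_cumulant E as"
  using assms(2)
proof (induction as rule: length_induct)
  case (1 as)
  have "[as] \<in> segmentations as"
    using 1 by (simp add: segmentations_def)
  then have "E (foldr (\<circ>) as id)
      = K as + (\<Sum>ps \<in> segmentations as - {[as]}. prod_list (map K ps))"
    using K[OF 1(2)] by (simp add: sum.remove[OF finite_segmentations])
  moreover have seg: "map K ps = map (bool_cumulant E) ps" if "ps \<in> segmentations as - {[as]}" for ps
  proof (intro map_cong refl)
    fix p assume "p \<in> set ps"
    with that have "length p < length as"
      by (auto dest: segmentation_smaller)
    moreover have "p \<noteq> []"
      using that \<open>p \<in> set ps\<close> by (auto simp: segmentations_def)
    ultimately show "K p = bool_cumulant E p" using 1 by blast
  qed
  then have "(\<Sum>ps \<in> segmentations as - {[as]}. prod_list (map K ps))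
      = (\<Sum>ps \<in> segmentations as - {[as]}. prod_list (map (bool_cumulant E) ps))"
    by (intro sum.cong refl arg_cong[where f = prod_list] seg)
  ultimately show ?case
    by (simp add: bool_cumulant.simps[of E as])
qed

definition block_cumulant ::
    "(nat \<Rightarrow> ('b::unital_cstar_algebra, 'h::ab_group_add) corr) \<Rightarrow> (nat \<Rightarrow> 'h) \<Rightarrow> (nat \<Rightarrow> nat)
      \<Rightarrow> nat set \<Rightarrow> (nat \<Rightarrow> 'h \<Rightarrow> 'h) \<Rightarrow> 'b" where
  "block_cumulant Hs \<xi>s col V a =
     bool_cumulant (\<lambda>x. ip (Hs (block_color col V)) (\<xi>s (block_color col V)) (x (\<xi>s (block_color col V))))
       (map a (sorted_list_of_set V))"


section \<open>The maps \<open>\<Lambda>\<close>\<close>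

text \<open>
  The recursion removes an arbitrary interval block, so it is written as an inductive relation
  between arguments and value. Instead of relabelling $[\ell] \setminus V$, it is run on partitions of
  arbitrary finite sets of naturals (the underlying set being \<open>\<Union>\<pi>\<close>); the successor of \<open>V\<close>, the index
  $k + 1$, is then the least element of \<open>\<Union>\<pi>\<close> lying above \<open>V\<close>.
\<close>

inductive Lambda_rel ::
    "(nat \<Rightarrow> ('b::unital_cstar_algebra, 'h::ab_group_add) corr) \<Rightarrow> (nat \<Rightarrow> 'h) \<Rightarrow> (nat \<Rightarrow> nat)
      \<Rightarrow> nat set set \<Rightarrow> (nat \<Rightarrow> 'h \<Rightarrow> 'h) \<Rightarrow> 'b \<Rightarrow> bool"
  for Hs :: "nat \<Rightarrow> ('b::unital_cstar_algebra, 'h::ab_group_add) corr"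
    and \<xi>s :: "nat \<Rightarrow> 'h" and col :: "nat \<Rightarrow> nat"
where
  Lambda_empty: "Lambda_rel Hs \<xi>s col {} a 1"
| Lambda_inner:
    "\<lbrakk>interval_block \<pi> V; {s \<in> \<Union>\<pi>. Max V < s} \<noteq> {}; k = Min {s \<in> \<Union>\<pi>. Max V < s};
      Lambda_rel Hs \<xi>s col (\<pi> - {V}) (a(k := lact (Hs (col k)) (block_cumulant Hs \<xi>s col V a) \<circ> a k)) v\<rbrakk>
     \<Longrightarrow> Lambda_rel Hs \<xi>s col \<pi> a v"
| Lambda_last:
    "\<lbrakk>interval_block \<pi> V; {s \<in> \<Union>\<pi>. Max V < s} = {}; Lambda_rel Hs \<xi>s col (\<pi> - {V}) a v\<rbrakk>
     \<Longrightarrow> Lambda_rel Hs \<xi>s col \<pi> a (v * block_cumulant Hs \<xi>s col V a)"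

definition Lambda ::
    "(nat \<Rightarrow> ('b::unital_cstar_algebra, 'h::ab_group_add) corr) \<Rightarrow> (nat \<Rightarrow> 'h) \<Rightarrow> (nat \<Rightarrow> nat)
      \<Rightarrow> nat set set \<Rightarrow> (nat \<Rightarrow> 'h \<Rightarrow> 'h) \<Rightarrow> 'b" where
  "Lambda Hs \<xi>s col \<pi> a = (THE v. Lambda_rel Hs \<xi>s col \<pi> a v)"

end

theory Submission
  imports Defs
begin

text \<open>
  With $Q = 1 - \xi\langle\xi, \cdot\rangle$, the Boolean cumulant is
  $K[a_1, \dots, a_m] = \langle \xi, a_1 Q a_2 Q \cdots Q a_m \xi\rangle$. Applied to an elementary tensor,
  $\lambda_j(x)$ is a sum of two elementary tensors (or zero): its first leg, a fresh vacuum vector or the leading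
  leg of color $j$, is hit by $x$ and then either compressed to the vacuum, which closes a block, or to the
  complement, which leaves the block open. Expanding the whole product from right to left thus produces one term per way of
  building a non-crossing partition with open blocks from right to left, and opening a block of color $j$ on a stack
  $s$ is possible exactly if $js \in \mathcal T$. Pairing with $\xi$ keeps the terms without open blocks. Along such a
  term, consecutive letters forming an interval block multiply the state by their Boolean cumulant, which can be
  absorbed into the operator to its right; this is the recursion for $\Lambda$.
\<close>

section \<open>Operators on a correspondence with a central unit vector\<close>

text \<open>Two obstacles shape the argument. The recursion for \<Lambda> removes interval blocks in
  any order, and B need not be commutative, so independence of the order has to be proved as well.
  The machine settles this: for a given partition it reads the word in one fixed order and sees the
  partition only through the letters that are maxima or minima of blocks, and every derivation of
  \<open>Lambda_rel\<close> turns out to compute its output. The second obstacle is that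
  \<open>NC\<close> tests the chains of a finished partition, while an expansion from right to left
  can test a color string only when a block is opened. Both tests agree because, in the completed
  partition, a block is enclosed by exactly those blocks that were on the stack when its maximum was
  read: as long as it is open, the blocks below it receive no letter, and each of them still needs
  one further to the left. Starting from the vacuum, every vector that occurs is a finite sum of
  elementary tensors, so the operators are evaluated by additivity on vectors where
  \<open>is_lambda\<close> prescribes them.\<close>

lemma star_zero: "star (0 :: 'b::unital_cstar_algebra) = 0"
  using star_add[of "0::'b" 0] by simp

context hilbert_module
begin

lemma diff_closed: "\<lbrakk>x \<in> carr H; y \<in> carr H\<rbrakk> \<Longrightarrow> x - y \<in> carr H"
  using add_closed[of x "- y"] uminus_closed[of y] by simp

lemma sum_closed: "(\<And>i. i \<in> I \<Longrightarrow> f i \<in> carr H) \<Longrightarrow> sum f I \<in> carr H"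
  by (induction I rule: infinite_finite_induct) (auto simp: zero_closed add_closed)

lemma ip_zero_right: "x \<in> carr H \<Longrightarrow> ip H x 0 = 0"
  using ip_add_right[of x 0 0] by (simp add: zero_closed)

lemma ip_diff_right:
  assumes "x \<in> carr H" "y \<in> carr H" "z \<in> carr H"
  shows "ip H x (y - z) = ip H x y - ip H x z"
  using ip_add_right[of x "y - z" z] assms by (simp add: diff_closed)

lemma ip_sum_right:
  "\<lbrakk>x \<in> carr H; \<And>i. i \<in> I \<Longrightarrow> f i \<in> carr H\<rbrakk> \<Longrightarrow> ip H x (sum f I) = (\<Sum>i\<in>I. ip H x (f i))"
  by (induction I rule: infinite_finite_induct)
     (auto simp: ip_zero_right ip_add_right sum_closed)

end

text \<open>The algebraic part of adjointability. It passes to compositions, in particular to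
  \<open>lact H b \<circ> a\<close>, the operator that the recursion for \<Lambda> puts in place of
  a letter.\<close>

definition modular :: "('b::unital_cstar_algebra, 'h::ab_group_add, 'm) hmod_scheme \<Rightarrow> ('h \<Rightarrow> 'h) \<Rightarrow> bool"
  where "modular H a \<longleftrightarrow>
    (\<forall>x\<in>carr H. a x \<in> carr H) \<and>
    (\<forall>x\<in>carr H. \<forall>y\<in>carr H. a (x + y) = a x + a y) \<and>
    (\<forall>x\<in>carr H. \<forall>b. a (ract H x b) = ract H (a x) b)"

lemma adjointable_modular: "a \<in> adjointable H \<Longrightarrow> modular H a"
  by (simp add: adjointable_def modular_def)

lemma modular_comp: "modular H a \<Longrightarrow> modular H c \<Longrightarrow> modular H (a \<circ> c)"
  by (simp add: modular_def)

lemma modular_closed: "modular H a \<Longrightarrow> x \<in> carr H \<Longrightarrow> a x \<in> carr H"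
  and modular_add: "modular H a \<Longrightarrow> x \<in> carr H \<Longrightarrow> y \<in> carr H \<Longrightarrow> a (x + y) = a x + a y"
  and modular_ract: "modular H a \<Longrightarrow> x \<in> carr H \<Longrightarrow> a (ract H x b) = ract H (a x) b"
  by (simp_all add: modular_def)

context hilbert_module
begin

lemma modular_zero: "modular H a \<Longrightarrow> a 0 = 0"
  using modular_add[of H a 0 0] by (simp add: zero_closed)

lemma modular_diff:
  assumes "modular H a" "x \<in> carr H" "y \<in> carr H"
  shows "a (x - y) = a x - a y"
  using modular_add[of H a "x - y" y] assms by (simp add: diff_closed)

lemma modular_sum:
  assumes "modular H a"
  shows "(\<And>i. i \<in> I \<Longrightarrow> f i \<in> carr H) \<Longrightarrow> a (sum f I) = (\<Sum>i\<in>I. a (f i))"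
  by (induction I rule: infinite_finite_induct)
     (auto simp: modular_zero[OF assms] modular_add[OF assms] sum_closed)

lemma modular_foldr_closed:
  assumes "\<forall>x\<in>set as. modular H x" "h \<in> carr H"
  shows "foldr (\<circ>) as id h \<in> carr H"
  using assms by (induction as) (auto simp: modular_closed)

end

lemma (in correspondence) modular_lact: "modular H (lact H b)"
  using lact_adjointable adjointable_modular by blast

text \<open>This is Q, the projection onto the complement of the vacuum line.\<close>

definition centre :: "('b, 'h::ab_group_add, 'm) hmod_scheme \<Rightarrow> 'h \<Rightarrow> 'h \<Rightarrow> 'h" where
  "centre H \<xi> y = y - ract H \<xi> (ip H \<xi> y)"

locale pointed_correspondence = correspondence H
  for H :: "('b::unital_cstar_algebra, 'h::ab_group_add, 'm) corr_scheme" and \<xi> :: 'h +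
  assumes cuv: "central_unit_vector H \<xi>"
begin

lemma xi_closed: "\<xi> \<in> carr H"
  and ip_xi_xi: "ip H \<xi> \<xi> = 1"
  and lact_xi: "lact H b \<xi> = ract H \<xi> b"
  using cuv by (simp_all add: central_unit_vector_def)

text \<open>Moved to the other side of the inner product, b acts on \<xi>, and there centrality
  trades the left action for the right one.\<close>

lemma ip_xi_lact:
  assumes "h \<in> carr H"
  shows "ip H \<xi> (lact H b h) = b * ip H \<xi> h"
proof -
  have "ip H \<xi> (lact H b h) = ip H (lact H (star b) \<xi>) h"
    using lact_star[OF xi_closed assms, of "star b"] by (simp add: star_star)
  also have "\<dots> = star (ip H h (ract H \<xi> (star b)))"
    using ip_star[OF assms] by (simp add: lact_xi xi_closed ract_closed)
  also have "\<dots> = b * star (ip H h \<xi>)"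
    by (simp add: ip_ract_right assms xi_closed star_mult star_star)
  also have "star (ip H h \<xi>) = ip H \<xi> h"
    using ip_star[OF assms xi_closed] by simp
  finally show ?thesis .
qed

lemma centre_closed: "y \<in> carr H \<Longrightarrow> centre H \<xi> y \<in> carr H"
  by (simp add: centre_def diff_closed ract_closed xi_closed)

lemma modular_centre: "modular H (centre H \<xi>)"
proof -
  have "modular H (\<lambda>y. ract H \<xi> (ip H \<xi> y))"
    by (simp add: modular_def ract_closed xi_closed ip_add_right ract_add_right ip_ract_right ract_mult)
  then have "centre H \<xi> (x + y) = centre H \<xi> x + centre H \<xi> y"
    if "x \<in> carr H" "y \<in> carr H" for x y
    using that by (simp add: centre_def modular_def)
  moreover have "ract H (x - y) b = ract H x b - ract H y b"
    if "x \<in> carr H" "y \<in> carr H" for x y b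
    using ract_add_left[of "x - y" y b] that by (simp add: diff_closed)
  ultimately show ?thesis
    by (auto simp: modular_def centre_closed)
       (simp add: centre_def ip_ract_right ract_mult ract_closed xi_closed)
qed

lemma ip_xi_centre: "y \<in> carr H \<Longrightarrow> ip H \<xi> (centre H \<xi> y) = 0"
  by (simp add: centre_def ip_diff_right xi_closed ract_closed ip_ract_right ip_xi_xi)

lemma centre_xi: "centre H \<xi> \<xi> = 0"
  by (simp add: centre_def ip_xi_xi ract_one xi_closed)

lemma centre_eq: "ip H \<xi> h = 0 \<Longrightarrow> centre H \<xi> h = h"
  using ract_add_right[OF xi_closed, of 0 0] by (simp add: centre_def)

text \<open>Left linearity of Q rests on centrality: b (\<xi> c) = \<xi> (b c). It lets a scalar
  arriving from the left enter a leg that stays open.\<close>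

lemma centre_lact:
  assumes "y \<in> carr H"
  shows "centre H \<xi> (lact H b y) = lact H b (centre H \<xi> y)"
proof -
  have "lact H b (centre H \<xi> y) = lact H b y - lact H b (ract H \<xi> (ip H \<xi> y))"
    unfolding centre_def by (intro modular_diff modular_lact assms ract_closed xi_closed)
  also have "lact H b (ract H \<xi> (ip H \<xi> y)) = ract H \<xi> (b * ip H \<xi> y)"
    by (simp add: modular_ract[OF modular_lact] xi_closed lact_xi ract_mult)
  finally show ?thesis
    by (simp add: centre_def ip_xi_lact assms)
qed

lemma centre_decomp: "y = centre H \<xi> y + ract H \<xi> (ip H \<xi> y)"
  by (simp add: centre_def)

end

section \<open>Boolean cumulants as moments of compressed products\<close>

lemma sum_segmentations:
  assumes "as \<noteq> []"
  shows "(\<Sum>ps\<in>segmentations as. f ps) =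
    (\<Sum>k\<in>{1..length as}. \<Sum>qs\<in>segmentations (drop k as). f (take k as # qs))"
proof -
  have "(\<Sum>k\<in>{1..length as}. \<Sum>qs\<in>segmentations (drop k as). f (take k as # qs)) =
      (\<Sum>(k, qs)\<in>(SIGMA k:{1..length as}. segmentations (drop k as)). f (take k as # qs))"
    by (rule sum.Sigma) (auto simp: finite_segmentations)
  also have "\<dots> = (\<Sum>ps\<in>segmentations as. f ps)"
  proof (rule sum.reindex_bij_witness[where i = "\<lambda>ps. (length (hd ps), tl ps)"
          and j = "\<lambda>(k, qs). take k as # qs"])
    fix ps assume "ps \<in> segmentations as"
    then obtain p qs where "ps = p # qs" "p \<noteq> []" "as = p @ concat qs" "[] \<notin> set qs"
      using assms by (cases ps) (auto simp: segmentations_def)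
    then show "(case (length (hd ps), tl ps) of (k, qs) \<Rightarrow> take k as # qs) = ps"
      and "(length (hd ps), tl ps) \<in> (SIGMA k:{1..length as}. segmentations (drop k as))"
      by (auto simp: segmentations_def Suc_le_eq)
  qed (use assms in \<open>auto simp: segmentations_def\<close>)
  finally show ?thesis by simp
qed

text \<open>Once the first segment is fixed, summing over the segmentations of the rest gives a
  moment again. The condition \<open>E id = 1\<close> covers the empty rest, where the sum is the
  empty product.\<close>

lemma bool_cumulant_first_segment:
  assumes "as \<noteq> []" "E id = 1"
  shows "E (foldr (\<circ>) as id) =
    (\<Sum>k\<in>{1..length as}. bool_cumulant E (take k as) * E (foldr (\<circ>) (drop k as) id))"
proof -
  have *: "(\<Sum>qs\<in>segmentations bs. prod_list (map (bool_cumulant E) qs)) = E (foldr (\<circ>) bs id)" for bs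
  proof (cases "bs = []")
    case True
    then have "segmentations bs = {[]}"
      by (auto simp: segmentations_def) (metis list.set_intros(1) neq_Nil_conv)
    then show ?thesis using True assms(2) by simp
  next
    case False
    then show ?thesis by (rule boolean_moment_cumulant[symmetric])
  qed
  have "E (foldr (\<circ>) as id) = (\<Sum>k\<in>{1..length as}. \<Sum>qs\<in>segmentations (drop k as).
      bool_cumulant E (take k as) * prod_list (map (bool_cumulant E) qs))"
    by (simp add: sum_segmentations[OF assms(1)] flip: *)
  also have "\<dots> = (\<Sum>k\<in>{1..length as}. bool_cumulant E (take k as) * E (foldr (\<circ>) (drop k as) id))"
    unfolding * sum_distrib_left[symmetric] ..
  finally show ?thesis .
qed

context pointed_correspondence
begin

text \<open>
  The vector $a_1 Q a_2 Q \cdots Q a_m \xi$ with $Q = 1 - \xi\langle\xi, \cdot\rangle$. Inserting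
  $1 = Q + \xi\langle\xi, \cdot\rangle$ between all factors of a moment shows that the Boolean
  cumulant is its vacuum component.
\<close>

fun bvec :: "('h \<Rightarrow> 'h) list \<Rightarrow> 'h" where
  "bvec [] = \<xi>"
| "bvec [x] = x \<xi>"
| "bvec (x # y # xs) = x (centre H \<xi> (bvec (y # xs)))"

lemma bvec_Cons: "xs \<noteq> [] \<Longrightarrow> bvec (x # xs) = x (centre H \<xi> (bvec xs))"
  by (cases xs) auto

lemma bvec_closed: "\<forall>x\<in>set as. modular H x \<Longrightarrow> bvec as \<in> carr H"
  by (induction as rule: bvec.induct) (auto simp: xi_closed modular_closed centre_closed)

text \<open>Here k marks the first place where the rank-one part of the identity is chosen: the
  first k operators are joined by Q, the others form an ordinary moment. The last term has an empty
  rest and coefficient 1.\<close>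

lemma foldr_xi_expand:
  assumes "as \<noteq> []" "\<forall>x\<in>set as. modular H x"
  shows "foldr (\<circ>) as id \<xi> =
    (\<Sum>k\<in>{1..length as}. ract H (bvec (take k as)) (ip H \<xi> (foldr (\<circ>) (drop k as) id \<xi>)))"
  using assms
proof (induction as)
  case (Cons x xs)
  show ?case
  proof (cases "xs = []")
    case True
    then show ?thesis
      using Cons.prems by (simp add: ip_xi_xi ract_one modular_closed xi_closed)
  next
    case False
    define e where "e k = ip H \<xi> (foldr (\<circ>) (drop k xs) id \<xi>)" for k
    define y where "y = foldr (\<circ>) xs id \<xi>"
    have x: "modular H x" and xs: "\<forall>z\<in>set xs. modular H z"
      using Cons.prems by auto
    have bc: "bvec (take k xs) \<in> carr H" for k
      by (rule bvec_closed) (use xs in_set_takeD in fast)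
    have y: "y \<in> carr H"
      unfolding y_def by (rule modular_foldr_closed[OF xs xi_closed])
    have IH: "y = (\<Sum>k\<in>{1..length xs}. ract H (bvec (take k xs)) (e k))"
      unfolding y_def e_def using Cons.IH False xs by blast
    have "x (centre H \<xi> y) = (\<Sum>k\<in>{1..length xs}. x (centre H \<xi> (ract H (bvec (take k xs)) (e k))))"
      unfolding IH
      by (simp add: modular_sum[OF modular_centre] modular_sum[OF x] bc ract_closed centre_closed)
    also have "\<dots> = (\<Sum>k\<in>{1..length xs}. ract H (bvec (x # take k xs)) (e k))"
      using False
      by (intro sum.cong refl) (auto simp: bvec_Cons modular_ract[OF modular_centre] modular_ract[OF x]
          bc centre_closed)
    finally have 1: "x (centre H \<xi> y) = (\<Sum>k\<in>{1..length xs}. ract H (bvec (x # take k xs)) (e k))" .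
    \<comment> \<open>The vacuum part of y gives the term whose first segment is \<open>[x]\<close>;
      the Q part prolongs the segments of the induction hypothesis by x. So the sum first starts at
      0 and is then shifted by one.\<close>
    have "x y = x (centre H \<xi> y + ract H \<xi> (ip H \<xi> y))"
      using centre_decomp[of y] by simp
    also have "\<dots> = x (centre H \<xi> y) + ract H (x \<xi>) (e 0)"
      by (simp add: modular_add[OF x] modular_ract[OF x] xi_closed ract_closed centre_closed y
            e_def flip: y_def)
    also have "\<dots> = (\<Sum>k\<in>{0..length xs}. ract H (bvec (x # take k xs)) (e k))"
      unfolding 1 by (subst (2) sum.atLeast_Suc_atMost) (simp_all add: add.commute)
    also have "\<dots> = (\<Sum>k\<in>{1..length (x # xs)}. ract H (bvec (take k (x # xs)))
        (ip H \<xi> (foldr (\<circ>) (drop k (x # xs)) id \<xi>)))"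
      by (rule sum.reindex_bij_witness[where i = "\<lambda>k. k - 1" and j = Suc])
         (auto simp: e_def)
    finally have "x y = (\<Sum>k\<in>{1..length (x # xs)}. ract H (bvec (take k (x # xs)))
        (ip H \<xi> (foldr (\<circ>) (drop k (x # xs)) id \<xi>)))" .
    moreover have "foldr (\<circ>) (x # xs) id \<xi> = x y"
      by (simp add: y_def)
    ultimately show ?thesis by (rule trans[rotated])
  qed
qed simp

text \<open>Cumulants and vacuum components of \<open>bvec\<close> satisfy the same expansion by the
  first segment. The terms with a proper first segment agree by induction, hence so does the
  remaining one, whose cofactor is \<open>E id = 1\<close>.\<close>

lemma bool_cumulant_eq:
  assumes "as \<noteq> []" "\<forall>x\<in>set as. modular H x"
  shows "bool_cumulant (\<lambda>x. ip H \<xi> (x \<xi>)) as = ip H \<xi> (bvec as)"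
  using assms
proof (induction as rule: length_induct)
  case (1 as)
  define E where "E x = ip H \<xi> (x \<xi>)" for x :: "'h \<Rightarrow> 'h"
  have E_abs: "(\<lambda>x. ip H \<xi> (x \<xi>)) = E"
    by (simp add: E_def fun_eq_iff)
  define n where "n = length as"
  have n: "n \<ge> 1" using 1(2) by (simp add: n_def Suc_le_eq)
  have mod: "\<forall>x\<in>set (take k as). modular H x" for k
    using 1(3) in_set_takeD by fast
  have "E (foldr (\<circ>) as id) =
      (\<Sum>k\<in>{1..length as}. ip H \<xi> (ract H (bvec (take k as)) (E (foldr (\<circ>) (drop k as) id))))"
    unfolding E_def
    by (subst foldr_xi_expand[OF 1(2,3)])
       (simp add: ip_sum_right xi_closed ract_closed bvec_closed mod)
  also have "\<dots> = (\<Sum>k\<in>{1..n}. ip H \<xi> (bvec (take k as)) * E (foldr (\<circ>) (drop k as) id))"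
    by (simp add: n_def ip_ract_right xi_closed bvec_closed mod)
  finally have A: "E (foldr (\<circ>) as id) = (\<Sum>k\<in>{1..n}. ip H \<xi> (bvec (take k as)) * E (foldr (\<circ>) (drop k as) id))" .
  have B: "E (foldr (\<circ>) as id) = (\<Sum>k\<in>{1..n}. bool_cumulant E (take k as) * E (foldr (\<circ>) (drop k as) id))"
    unfolding n_def by (rule bool_cumulant_first_segment[OF 1(2)]) (simp add: E_def ip_xi_xi)
  have eq: "bool_cumulant E (take k as) = ip H \<xi> (bvec (take k as))" if "k \<in> {1..<n}" for k
    using 1(1)[rule_format, of "take k as"] that 1(2) mod[of k] by (simp add: E_abs n_def)
  have split: "(\<Sum>k\<in>{1..n}. g k) = (\<Sum>k\<in>{1..<n}. g k) + g n" for g :: "nat \<Rightarrow> 'b"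
    using n by (metis sum.last_plus add.commute)
  have "E id = 1" by (simp add: E_def ip_xi_xi)
  moreover have "(\<Sum>k\<in>{1..<n}. bool_cumulant E (take k as) * E (foldr (\<circ>) (drop k as) id)) =
      (\<Sum>k\<in>{1..<n}. ip H \<xi> (bvec (take k as)) * E (foldr (\<circ>) (drop k as) id))"
    by (intro sum.cong refl) (simp only: eq)
  ultimately show ?case
    using A B unfolding split by (simp add: n_def E_abs)
qed

end

section \<open>The stack machine\<close>

text \<open>\<open>Hs\<close> and \<open>\<xi>s\<close> are total functions on the naturals; J
  singles out the colors at which they are meaningful.\<close>

locale pointed_family =
  fixes J :: "nat set"
    and Hs :: "nat \<Rightarrow> ('b::unital_cstar_algebra, 'h::ab_group_add) corr"
    and \<xi>s :: "nat \<Rightarrow> 'h"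
  assumes pointed: "j \<in> J \<Longrightarrow> pointed_correspondence (Hs j) (\<xi>s j)"
begin

text \<open>
  A pair \<open>(st, b)\<close> stands for the elementary tensor $h_1 \otimes \cdots \otimes h_d \otimes b$, where the
  stack \<open>st\<close> lists the centered vectors $h_i$ with their colors; a nonempty stack entry is a block still open
  to the left.
\<close>

fun smul :: "'b \<Rightarrow> (nat \<times> 'h) list \<times> 'b \<Rightarrow> (nat \<times> 'h) list \<times> 'b" where
  "smul c ([], b) = ([], c * b)"
| "smul c ((j, h) # st, b) = ((j, lact (Hs j) c h) # st, b)"

definition finish :: "bool \<Rightarrow> nat \<Rightarrow> 'h \<Rightarrow> (nat \<times> 'h) list \<times> 'b \<Rightarrow> (nat \<times> 'h) list \<times> 'b" where
  "finish fin c y S =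
    (if fin then smul (ip (Hs c) (\<xi>s c) y) S else ((c, centre (Hs c) (\<xi>s c) y) # fst S, snd S))"

text \<open>
  One operator acts either on a fresh vacuum vector (first flag) or on the top of the stack, and its result is
  compressed to the vacuum line (second flag) or to its complement. \<open>None\<close> marks a color mismatch or
  an empty stack.
\<close>

fun step :: "bool \<Rightarrow> bool \<Rightarrow> nat \<Rightarrow> ('h \<Rightarrow> 'h) \<Rightarrow> (nat \<times> 'h) list \<times> 'b \<Rightarrow> ((nat \<times> 'h) list \<times> 'b) option"
  where
  "step True fin c x S = Some (finish fin c (x (\<xi>s c)) S)"
| "step False fin c x ([], b) = None"
| "step False fin c x ((j, h) # st, b) = (if j = c then Some (finish fin c (x h) (st, b)) else None)"

text \<open>
  The list is processed from right to left; \<open>M\<close> and \<open>F\<close> are the maxima of the blocks and the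
  minima of the closed blocks.
\<close>

fun run :: "(nat \<Rightarrow> nat) \<Rightarrow> nat set \<Rightarrow> nat set \<Rightarrow> (nat \<Rightarrow> 'h \<Rightarrow> 'h) \<Rightarrow> (nat \<times> 'h) list \<times> 'b \<Rightarrow> nat list
    \<Rightarrow> ((nat \<times> 'h) list \<times> 'b) option" where
  "run col M F a S [] = Some S"
| "run col M F a S (i # is) = Option.bind (run col M F a S is) (step (i \<in> M) (i \<in> F) (col i) (a i))"

definition wf_stack :: "(nat \<times> 'h) list \<Rightarrow> bool" where
  "wf_stack st \<longleftrightarrow> (\<forall>(j, h)\<in>set st. j \<in> J \<and> h \<in> carr (Hs j) \<and> ip (Hs j) (\<xi>s j) h = 0)"

lemma xi_in: "j \<in> J \<Longrightarrow> \<xi>s j \<in> carr (Hs j)"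
  using pointed pointed_correspondence.xi_closed by blast

lemma wf_stack_Nil: "wf_stack []"
  and wf_stack_Cons: "wf_stack ((j, h) # st) \<longleftrightarrow>
    j \<in> J \<and> h \<in> carr (Hs j) \<and> ip (Hs j) (\<xi>s j) h = 0 \<and> wf_stack st"
  by (auto simp: wf_stack_def)

lemma wf_smul: "wf_stack (fst S) \<Longrightarrow> wf_stack (fst (smul c S))"
proof (induction c S rule: smul.induct)
  case (2 c j h st b)
  then interpret pointed_correspondence "Hs j" "\<xi>s j"
    by (intro pointed) (simp add: wf_stack_Cons)
  from 2 show ?case
    by (simp add: wf_stack_Cons modular_closed[OF modular_lact] ip_xi_lact)
qed simp

lemma smul_smul: "wf_stack (fst S) \<Longrightarrow> smul c (smul d S) = smul (c * d) S"
proof (induction d S rule: smul.induct)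
  case (2 d j h st b)
  then interpret pointed_correspondence "Hs j" "\<xi>s j"
    by (intro pointed) (simp add: wf_stack_Cons)
  from 2 show ?case
    by (simp add: wf_stack_Cons lact_mult)
qed (simp add: mult.assoc)

lemma wf_finish:
  assumes "c \<in> J" "y \<in> carr (Hs c)" "wf_stack (fst S)"
  shows "wf_stack (fst (finish fin c y S))"
proof -
  interpret pointed_correspondence "Hs c" "\<xi>s c"
    using assms by (intro pointed)
  show ?thesis
    using assms by (simp add: finish_def wf_smul wf_stack_Cons centre_closed ip_xi_centre)
qed

lemma finish_lact:
  assumes "c \<in> J" "y \<in> carr (Hs c)" "wf_stack (fst S)"
  shows "finish fin c (lact (Hs c) b y) S = smul b (finish fin c y S)"
proof -
  interpret pointed_correspondence "Hs c" "\<xi>s c"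
    using assms by (intro pointed)
  show ?thesis
    using assms by (simp add: finish_def smul_smul ip_xi_lact centre_lact)
qed

lemma wf_step:
  assumes "step new fin c x S = Some S'" "c \<in> J" "modular (Hs c) x" "wf_stack (fst S)"
  shows "wf_stack (fst S')"
  using assms
  by (induction new fin c x S rule: step.induct)
     (auto simp: wf_stack_Cons modular_closed xi_in intro!: wf_finish split: if_splits)

text \<open>This is how a cumulant is absorbed: a left factor on the operator of a letter has the
  same effect as multiplying the state after that letter has been read.\<close>

lemma step_lact:
  assumes "c \<in> J" "modular (Hs c) x" "wf_stack (fst S)"
  shows "step new fin c (lact (Hs c) b \<circ> x) S = map_option (smul b) (step new fin c x S)"
  using assms
  by (induction new fin c x S rule: step.induct)
     (auto simp: wf_stack_Cons modular_closed xi_in finish_lact)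

lemma run_append:
  "run col M F a S (is @ js) = Option.bind (run col M F a S js) (\<lambda>S'. run col M F a S' is)"
  by (induction "is") simp_all

text \<open>A run sees the partition only through the flags of the letters it reads. A block may
  thus be deleted, or a new letter added, without disturbing the rest of the run.\<close>

lemma run_cong:
  assumes "\<And>i. i \<in> set is \<Longrightarrow> (i \<in> M \<longleftrightarrow> i \<in> M') \<and> (i \<in> F \<longleftrightarrow> i \<in> F') \<and> a i = a' i"
  shows "run col M F a S is = run col M' F' a' S is"
  using assms by (induction "is") simp_all

lemma wf_run:
  assumes "run col M F a S is = Some S'" "wf_stack (fst S)"
    and "\<And>i. i \<in> set is \<Longrightarrow> col i \<in> J \<and> modular (Hs (col i)) (a i)"
  shows "wf_stack (fst S')"
  using assms
proof (induction "is" arbitrary: S')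
  case (Cons i "is")
  then obtain S'' where "run col M F a S is = Some S''" "step (i \<in> M) (i \<in> F) (col i) (a i) S'' = Some S'"
    by (auto simp: Option.bind_eq_Some_conv)
  with Cons show ?case
    using wf_step by (metis list.set_intros)
qed simp

section \<open>The bottom coefficient, and runs over a single block\<close>

lemma smul_bottom: "smul c (st, b * d) = (fst (smul c (st, b)), snd (smul c (st, b)) * d)"
  by (cases st) (auto simp: mult.assoc)

lemma finish_bottom: "finish fin c y (st, b * d) = (fst (finish fin c y (st, b)), snd (finish fin c y (st, b)) * d)"
  by (auto simp: finish_def smul_bottom)

lemma step_bottom:
  "step new fin c x (st, b) = Some (st', b') \<Longrightarrow> step new fin c x (st, b * d) = Some (st', b' * d)"
  by (cases new; cases st) (auto simp: finish_bottom split: if_splits)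

text \<open>All factors reach the bottom coefficient from the left, so a right factor is carried
  along unchanged. It becomes the trailing cumulant in \<open>Lambda_last\<close>.\<close>

lemma run_bottom:
  "run col M F a (st, b) is = Some (st', b') \<Longrightarrow> run col M F a (st, b * d) is = Some (st', b' * d)"
proof (induction "is" arbitrary: st' b')
  case (Cons i "is")
  then show ?case
    using step_bottom by (auto simp: Option.bind_eq_Some_conv)
qed simp

text \<open>The invariant while the maximum of a block has been read and its minimum is still to
  come: the top leg holds the Q-compressed product of the letters read, above an untouched
  stack.\<close>

lemma run_open_block:
  assumes "c \<in> J" "is \<noteq> []" "distinct is"
    and "\<And>i. i \<in> set is \<Longrightarrow> col i = c \<and> modular (Hs c) (a i) \<and> (i \<in> M \<longleftrightarrow> i = last is) \<and> i \<notin> F"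
  shows "run col M F a (st, b) is =
    Some ((c, centre (Hs c) (\<xi>s c) (pointed_correspondence.bvec (Hs c) (\<xi>s c) (map a is))) # st, b)"
proof -
  interpret pointed_correspondence "Hs c" "\<xi>s c"
    using assms by (intro pointed)
  show ?thesis
    using assms(2-)
  proof (induction "is")
    case (Cons i "is")
    show ?case
    proof (cases "is = []")
      case True
      then show ?thesis using Cons.prems by (simp add: finish_def)
    next
      case False
      then have "i \<notin> M" "i \<notin> F" "col i = c" using Cons.prems(2,3)
        by (auto simp del: last.simps split: if_splits)
           (metis last_ConsR last_in_set list.set_intros(1))
      moreover have "run col M F a (st, b) is =
          Some ((c, centre (Hs c) (\<xi>s c) (bvec (map a is))) # st, b)"
        using False Cons.prems by (intro Cons.IH) auto
      ultimately show ?thesis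
        using False by (simp add: finish_def bvec_Cons)
    qed
  qed simp
qed

text \<open>The letter read last is the head, the minimum. It takes the vacuum component of the
  compressed product, which is the cumulant by \<open>bool_cumulant_eq\<close>, and passes it to the
  stack below as a left factor.\<close>

lemma run_block:
  assumes "c \<in> J" "is \<noteq> []" "distinct is"
    and is': "\<And>i. i \<in> set is \<Longrightarrow>
      col i = c \<and> modular (Hs c) (a i) \<and> (i \<in> M \<longleftrightarrow> i = last is) \<and> (i \<in> F \<longleftrightarrow> i = hd is)"
  shows "run col M F a S is =
    Some (smul (bool_cumulant (\<lambda>x. ip (Hs c) (\<xi>s c) (x (\<xi>s c))) (map a is)) S)"
proof -
  interpret pointed_correspondence "Hs c" "\<xi>s c"
    using assms by (intro pointed)
  obtain st b where S: "S = (st, b)" by (cases S)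
  obtain i js where ijs: "is = i # js" using assms(2) by (cases "is") auto
  have *: "bool_cumulant (\<lambda>x. ip (Hs c) (\<xi>s c) (x (\<xi>s c))) (map a is) = ip (Hs c) (\<xi>s c) (bvec (map a is))"
    using assms(2) is' by (intro bool_cumulant_eq) auto
  show ?thesis
  proof (cases "js = []")
    case True
    then show ?thesis
      using is'[of i] unfolding * by (simp add: ijs finish_def)
  next
    case False
    have "last js \<in> set js" using False by simp
    then have "i \<noteq> last js" using assms(3) ijs by auto
    then have "i \<notin> M" "i \<in> F" "col i = c"
      using False is'[of i] by (auto simp: ijs)
    moreover have "run col M F a (st, b) js =
          Some ((c, centre (Hs c) (\<xi>s c) (bvec (map a js))) # st, b)"
    proof (rule run_open_block)
      fix k assume "k \<in> set js"
      then show "col k = c \<and> modular (Hs c) (a k) \<and> (k \<in> M \<longleftrightarrow> k = last js) \<and> k \<notin> F"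
        using is'[of k] False assms(3) by (auto simp: ijs)
    qed (use assms False ijs in auto)
    ultimately show ?thesis
      using False unfolding * by (simp add: ijs S finish_def bvec_Cons)
  qed
qed

end

section \<open>Evaluating the maps \<Lambda>\<close>

text \<open>A finite partition of its own union. Deleting a block keeps this property, so the
  recursion for \<Lambda> can be followed without relabelling.\<close>

definition blocks_disjoint :: "'i set set \<Rightarrow> bool" where
  "blocks_disjoint \<pi> \<longleftrightarrow> finite (\<Union>\<pi>) \<and> {} \<notin> \<pi> \<and> disjoint \<pi>"

lemma blocks_disjoint_finite: "blocks_disjoint \<pi> \<Longrightarrow> A \<subseteq> \<Union>\<pi> \<Longrightarrow> finite A"
  by (auto simp: blocks_disjoint_def intro: finite_subset)

lemma sorted_list_of_set_union_less:
  fixes A B :: "'i::linorder set"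
  assumes "finite A" "finite B" "\<And>x y. x \<in> A \<Longrightarrow> y \<in> B \<Longrightarrow> x < y"
  shows "sorted_list_of_set (A \<union> B) = sorted_list_of_set A @ sorted_list_of_set B"
  by (rule strict_sorted_equal[symmetric]) (use assms in \<open>auto simp: sorted_wrt_append\<close>)

lemma last_sorted_list_of_set:
  fixes A :: "'i::linorder set"
  assumes "finite A" "A \<noteq> {}"
  shows "last (sorted_list_of_set A) = Max A"
proof -
  have "sorted_list_of_set A = sorted_list_of_set (A - {Max A} \<union> {Max A})"
    using assms by (simp add: insert_absorb)
  also have "\<dots> = sorted_list_of_set (A - {Max A}) @ sorted_list_of_set {Max A}"
    using assms by (intro sorted_list_of_set_union_less) (auto simp: less_le)
  finally show ?thesis by simp
qed

text \<open>An interval block is contiguous in the word of all letters, so a run factors into the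
  letters above V, then V, then the letters below.\<close>

lemma interval_block_split:
  assumes "interval_block \<pi> V" "blocks_disjoint \<pi>"
  defines "A \<equiv> {s\<in>\<Union>\<pi>. s < Min V}" and "B \<equiv> {s\<in>\<Union>\<pi>. Max V < s}"
  shows "sorted_list_of_set (\<Union>\<pi>) = sorted_list_of_set A @ sorted_list_of_set V @ sorted_list_of_set B"
    and "sorted_list_of_set (\<Union>(\<pi> - {V})) = sorted_list_of_set A @ sorted_list_of_set B"
proof -
  have V: "V \<in> \<pi>" "finite V" "V \<noteq> {}" "V \<subseteq> \<Union>\<pi>"
    using assms(1,2) finite_subset[of V "\<Union>\<pi>"] by (auto simp: interval_block_def blocks_disjoint_def)
  have MM: "Min V \<in> V" "Max V \<in> V" using V by auto
  have fin: "finite A" "finite B"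
    unfolding A_def B_def by (rule blocks_disjoint_finite[OF assms(2)], blast)+
  have mid: "s \<in> V" if "s \<in> \<Union>\<pi>" "\<not> s < Min V" "\<not> Max V < s" for s
    using that MM assms(1) unfolding interval_block_def
    by (metis linorder_neqE)
  have U: "\<Union>\<pi> = A \<union> (V \<union> B)"
    using V(4) mid by (auto simp: A_def B_def)
  have V_less: "x < y" if "x \<in> V" "y \<in> B" for x y
    using that V Max_ge[OF V(2), of x] by (auto simp: B_def)
  have A_less: "x < y" if "x \<in> A" "y \<in> V" for x y
    using that V Min_le[OF V(2), of y] by (auto simp: A_def)
  have AB_less: "x < y" if "x \<in> A" "y \<in> B" for x y
    using A_less[OF that(1) MM(1)] V_less[OF MM(1) that(2)] by order
  have "\<Union>(\<pi> - {V}) = \<Union>\<pi> - V"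
    using assms(2) V(1) by (auto simp: blocks_disjoint_def disjoint_def)
  then have U': "\<Union>(\<pi> - {V}) = A \<union> B"
    unfolding U using A_less V_less by blast
  show "sorted_list_of_set (\<Union>\<pi>) = sorted_list_of_set A @ sorted_list_of_set V @ sorted_list_of_set B"
    unfolding U using sorted_list_of_set_union_less[of A "V \<union> B"] sorted_list_of_set_union_less[of V B]
      A_less AB_less V_less fin V(2) by (metis Un_iff finite_Un)
  show "sorted_list_of_set (\<Union>(\<pi> - {V})) = sorted_list_of_set A @ sorted_list_of_set B"
    unfolding U' using AB_less fin by (intro sorted_list_of_set_union_less)
qed

lemma blocks_disjoint_remove: "blocks_disjoint \<pi> \<Longrightarrow> blocks_disjoint (\<pi> - {V})"
  using blocks_disjoint_finite[of \<pi> "\<Union>(\<pi> - {V})"] by (auto simp: blocks_disjoint_def disjoint_def)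

lemma blocks_disjoint_block:
  "blocks_disjoint \<pi> \<Longrightarrow> V \<in> \<pi> \<Longrightarrow> finite V \<and> V \<noteq> {}"
  using blocks_disjoint_finite[of \<pi> V] by (auto simp: blocks_disjoint_def)

lemma block_extrema_iff:
  fixes \<pi> :: "'i::linorder set set"
  assumes "blocks_disjoint \<pi>" "V \<in> \<pi>" "i \<in> V"
  shows "i \<in> Max ` \<pi> \<longleftrightarrow> i = Max V" "i \<in> Min ` \<pi> \<longleftrightarrow> i = Min V"
proof -
  have "W = V" if "W \<in> \<pi>" "i \<in> W" for W
    using assms that by (auto simp: blocks_disjoint_def disjoint_def)
  moreover have "Max W \<in> W" "Min W \<in> W" if "W \<in> \<pi>" for W
    using blocks_disjoint_block[OF assms(1) that] by auto
  ultimately show "i \<in> Max ` \<pi> \<longleftrightarrow> i = Max V" "i \<in> Min ` \<pi> \<longleftrightarrow> i = Min V"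
    using assms(2) by blast+
qed

lemma block_extrema_remove:
  fixes \<pi> :: "'i::linorder set set"
  assumes "blocks_disjoint \<pi>" "V \<in> \<pi>" "i \<notin> V"
  shows "i \<in> Max ` (\<pi> - {V}) \<longleftrightarrow> i \<in> Max ` \<pi>" "i \<in> Min ` (\<pi> - {V}) \<longleftrightarrow> i \<in> Min ` \<pi>"
proof -
  have "Max V \<noteq> i" "Min V \<noteq> i"
    using blocks_disjoint_block[OF assms(1,2)] assms(3) Max_in[of V] Min_in[of V] by blast+
  then show "i \<in> Max ` (\<pi> - {V}) \<longleftrightarrow> i \<in> Max ` \<pi>" "i \<in> Min ` (\<pi> - {V}) \<longleftrightarrow> i \<in> Min ` \<pi>"
    by auto
qed

context pointed_family
begin

abbreviation run_blocks :: "(nat \<Rightarrow> nat) \<Rightarrow> nat set set \<Rightarrow> (nat \<Rightarrow> 'h \<Rightarrow> 'h) \<Rightarrow> nat list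
    \<Rightarrow> ((nat \<times> 'h) list \<times> 'b) option" where
  "run_blocks col \<pi> a \<equiv> run col (Max ` \<pi>) (Min ` \<pi>) a ([], 1)"

lemma run_interval_block:
  assumes "blocks_disjoint \<pi>" "V \<in> \<pi>"
    and "\<And>i. i \<in> V \<Longrightarrow> col i \<in> J \<and> modular (Hs (col i)) (a i)"
    and "\<And>i j. i \<in> V \<Longrightarrow> j \<in> V \<Longrightarrow> col i = col j"
  shows "run col (Max ` \<pi>) (Min ` \<pi>) a S (sorted_list_of_set V) = Some (smul (block_cumulant Hs \<xi>s col V a) S)"
proof -
  have V: "finite V" "V \<noteq> {}"
    using blocks_disjoint_block[OF assms(1,2)] by auto
  then obtain v where v: "v \<in> V" by auto
  have "col ` V = {col v}" using assms(4) v by blast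
  then have c: "block_color col V = col v" by (simp add: block_color_def)
  have ends: "last (sorted_list_of_set V) = Max V" "hd (sorted_list_of_set V) = Min V"
    using last_sorted_list_of_set[OF V] sorted_list_of_set_nonempty[OF V] by (simp_all only: list.sel(1))
  show ?thesis
    unfolding block_cumulant_def c
  proof (rule run_block)
    fix i assume "i \<in> set (sorted_list_of_set V)"
    then have i: "i \<in> V" using V by simp
    have "col i = col v" using assms(4) v i by blast
    then show "col i = col v \<and> modular (Hs (col v)) (a i) \<and>
       (i \<in> Max ` \<pi> \<longleftrightarrow> i = last (sorted_list_of_set V)) \<and> (i \<in> Min ` \<pi> \<longleftrightarrow> i = hd (sorted_list_of_set V))"
      unfolding ends block_extrema_iff[OF assms(1,2) i] using assms(3)[OF i] by simp
  qed (use V assms(3)[OF v] in simp_all)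
qed

text \<open>The right-hand side depends on the derivation only through v, while the left-hand side
  does not depend on it at all; this is what makes the order of removal irrelevant. The induction
  puts the removed block back into the word at the place where its cumulant acts.\<close>

lemma Lambda_rel_run:
  assumes "Lambda_rel Hs \<xi>s col \<pi> a v" "blocks_disjoint \<pi>"
    and "\<And>i. i \<in> \<Union>\<pi> \<Longrightarrow> col i \<in> J \<and> modular (Hs (col i)) (a i)"
    and "\<And>V i j. V \<in> \<pi> \<Longrightarrow> i \<in> V \<Longrightarrow> j \<in> V \<Longrightarrow> col i = col j"
  shows "run_blocks col \<pi> a (sorted_list_of_set (\<Union>\<pi>)) = Some ([], v)"
  using assms
proof (induction rule: Lambda_rel.induct)
  case (Lambda_empty a)
  then show ?case by simp
next
  case (Lambda_last \<pi> V a v)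
  let ?K = "block_cumulant Hs \<xi>s col V a"
  let ?A = "{s\<in>\<Union>\<pi>. s < Min V}"
  have V: "V \<in> \<pi>" using Lambda_last.hyps(1) by (simp add: interval_block_def)
  have A: "finite ?A" "?A \<inter> V = {}"
    using blocks_disjoint_finite[OF Lambda_last.prems(1), of ?A]
      blocks_disjoint_block[OF Lambda_last.prems(1) V] by auto
  have "run_blocks col (\<pi> - {V}) a (sorted_list_of_set (\<Union>(\<pi> - {V}))) = Some ([], v)"
  proof (rule Lambda_last.IH[OF blocks_disjoint_remove[OF Lambda_last.prems(1)]])
    show "col i \<in> J \<and> modular (Hs (col i)) (a i)" if "i \<in> \<Union>(\<pi> - {V})" for i
      using that by (intro Lambda_last.prems(2)) blast
    show "col i = col j" if "U \<in> \<pi> - {V}" "i \<in> U" "j \<in> U" for U i j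
      using that by (intro Lambda_last.prems(3)[of U]) blast+
  qed
  then have "run_blocks col (\<pi> - {V}) a (sorted_list_of_set ?A) = Some ([], v)"
    unfolding interval_block_split(2)[OF Lambda_last.hyps(1) Lambda_last.prems(1)]
    by (simp add: Lambda_last.hyps(2) del: Union_iff)
  also have "run_blocks col (\<pi> - {V}) a (sorted_list_of_set ?A) = run_blocks col \<pi> a (sorted_list_of_set ?A)"
    using A by (intro run_cong) (simp add: block_extrema_remove[OF Lambda_last.prems(1) V] disjoint_iff)
  \<comment> \<open>Here V is the end of the word and is read first, turning the initial coefficient
    1 into the cumulant; the rest of the run carries it as a right factor.\<close>
  finally have "run col (Max ` \<pi>) (Min ` \<pi>) a ([], 1 * ?K) (sorted_list_of_set ?A) = Some ([], v * ?K)"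
    by (rule run_bottom)
  moreover have "run_blocks col \<pi> a (sorted_list_of_set V) = Some (smul ?K ([], 1))"
    using V by (intro run_interval_block Lambda_last.prems(1,2)) (blast, blast, rule Lambda_last.prems(3))
  ultimately show ?case
    unfolding interval_block_split(1)[OF Lambda_last.hyps(1) Lambda_last.prems(1)]
    by (simp add: Lambda_last.hyps(2) run_append del: Union_iff)
next
  case (Lambda_inner \<pi> V k a v)
  let ?K = "block_cumulant Hs \<xi>s col V a"
  let ?A = "{s\<in>\<Union>\<pi>. s < Min V}" and ?B = "{s\<in>\<Union>\<pi>. Max V < s}"
  let ?B' = "?B - {k}"
  let ?a = "a(k := lact (Hs (col k)) ?K \<circ> a k)"
  let ?run = "run col (Max ` \<pi>) (Min ` \<pi>)"
  let ?run' = "run col (Max ` (\<pi> - {V})) (Min ` (\<pi> - {V}))"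
  note dis = Lambda_inner.prems(1) and iv = Lambda_inner.hyps(1)
  have V: "V \<in> \<pi>" using iv by (simp add: interval_block_def)
  have fV: "finite V" "V \<noteq> {}" using blocks_disjoint_block[OF dis V] by auto
  have fin: "finite ?A" "finite ?B" by (rule blocks_disjoint_finite[OF dis], blast)+
  have AV: "s \<notin> V" if "s \<in> ?A" for s using that fV Min_le[OF fV(1)] by (auto simp: leD)
  have BV: "s \<notin> V" if "s \<in> ?B" for s using that fV Max_ge[OF fV(1)] by (auto simp: leD)
  have k: "k \<in> ?B" using Lambda_inner.hyps(2,3) fin Min_in by blast
  have kU: "k \<in> \<Union>\<pi>" using k by blast
  have kA: "k \<notin> ?A" using k Min_le[OF fV(1)] Max_in[OF fV] by fastforce
  have Bk: "sorted_list_of_set ?B = k # sorted_list_of_set ?B'"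
    unfolding Lambda_inner.hyps(3) using fin Lambda_inner.hyps(2) by (intro sorted_list_of_set_nonempty)
  have colk: "col k \<in> J" "modular (Hs (col k)) (a k)"
    using Lambda_inner.prems(2)[OF kU] by auto
  then interpret pointed_correspondence "Hs (col k)" "\<xi>s (col k)" by (intro pointed)
  have "?run' ?a ([], 1) (sorted_list_of_set (\<Union>(\<pi> - {V}))) = Some ([], v)"
  proof (rule Lambda_inner.IH[OF blocks_disjoint_remove[OF dis]])
    show "col i \<in> J \<and> modular (Hs (col i)) (?a i)" if "i \<in> \<Union>(\<pi> - {V})" for i
      using that Lambda_inner.prems(2)[of i] colk by (auto simp: modular_comp modular_lact)
    show "col i = col j" if "U \<in> \<pi> - {V}" "i \<in> U" "j \<in> U" for U i j
      using that by (intro Lambda_inner.prems(3)[of U]) blast+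
  qed
  moreover have runA: "?run' ?a S (sorted_list_of_set ?A) = ?run a S (sorted_list_of_set ?A)" for S
  proof (rule run_cong)
    fix i assume "i \<in> set (sorted_list_of_set ?A)"
    then have "i \<in> ?A" using fin by simp
    with kA have "i \<noteq> k" by blast
    with block_extrema_remove[OF dis V AV[OF \<open>i \<in> ?A\<close>]] show "(i \<in> Max ` (\<pi> - {V}) \<longleftrightarrow> i \<in> Max ` \<pi>) \<and> (i \<in> Min ` (\<pi> - {V}) \<longleftrightarrow> i \<in> Min ` \<pi>) \<and> ?a i = a i"
      by (simp only: fun_upd_apply if_False)
  qed
  moreover have runB: "?run' ?a S (sorted_list_of_set ?B') = ?run a S (sorted_list_of_set ?B')" for S
  proof (rule run_cong)
    fix i assume "i \<in> set (sorted_list_of_set ?B')"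
    then have "i \<in> ?B" "i \<noteq> k" using fin by simp_all
    with block_extrema_remove[OF dis V BV[OF this(1)]] show "(i \<in> Max ` (\<pi> - {V}) \<longleftrightarrow> i \<in> Max ` \<pi>) \<and> (i \<in> Min ` (\<pi> - {V}) \<longleftrightarrow> i \<in> Min ` \<pi>) \<and> ?a i = a i"
      by (simp only: fun_upd_apply if_False)
  qed
  ultimately obtain S T where S: "?run a ([], 1) (sorted_list_of_set ?B') = Some S"
    and T: "step (k \<in> Max ` (\<pi> - {V})) (k \<in> Min ` (\<pi> - {V})) (col k) (?a k) S = Some T"
    and v: "?run a T (sorted_list_of_set ?A) = Some ([], v)"
    unfolding interval_block_split(2)[OF iv dis] Bk run_append
    by (auto simp: Option.bind_eq_Some_conv simp del: Union_iff)
  have "wf_stack (fst S)"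
  proof (rule wf_run[OF S])
    fix i assume "i \<in> set (sorted_list_of_set ?B')"
    then have "i \<in> \<Union>\<pi>" using fin by simp
    then show "col i \<in> J \<and> modular (Hs (col i)) (a i)" by (rule Lambda_inner.prems(2))
  qed (simp add: wf_stack_Nil)
  \<comment> \<open>The factor put into the operator at k may be applied after reading the
    unmodified letter k. The letters directly to the left of k are those of V, and their run applies
    exactly this factor.\<close>
  then obtain T' where T': "step (k \<in> Max ` \<pi>) (k \<in> Min ` \<pi>) (col k) (a k) S = Some T'" "T = smul ?K T'"
    using T unfolding block_extrema_remove[OF dis V BV[OF k]]
    by (auto simp: step_lact[OF colk] simp del: Union_iff)
  have "?run a T' (sorted_list_of_set V) = Some T"
    unfolding T'(2) using V
    by (intro run_interval_block dis Lambda_inner.prems(2)) (blast, blast, rule Lambda_inner.prems(3))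
  then show ?case
    unfolding interval_block_split(1)[OF iv dis] Bk run_append using S T'(1) v
    by (simp del: Union_iff)
qed

end

section \<open>Existence of interval blocks and well-definedness of \<Lambda>\<close>

definition noncrossing :: "'i::linorder set set \<Rightarrow> bool" where
  "noncrossing \<pi> \<longleftrightarrow> \<not> (\<exists>V\<in>\<pi>. \<exists>W\<in>\<pi>. V \<noteq> W \<and>
     (\<exists>a b c d. a < b \<and> b < c \<and> c < d \<and> a \<in> V \<and> b \<in> W \<and> c \<in> V \<and> d \<in> W))"

lemma noncrossingD:
  "\<lbrakk>noncrossing \<pi>; V \<in> \<pi>; W \<in> \<pi>; a < b; b < c; c < d; a \<in> V; b \<in> W; c \<in> V; d \<in> W\<rbrakk> \<Longrightarrow> V = W"
  unfolding noncrossing_def by metis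

lemma noncrossing_mono: "noncrossing \<pi> \<Longrightarrow> \<sigma> \<subseteq> \<pi> \<Longrightarrow> noncrossing \<sigma>"
  unfolding noncrossing_def by (meson subsetD)

text \<open>A block of least width works: a block with a point in one of its gaps could not cross
  it, hence would lie strictly between its extrema and be narrower.\<close>

lemma noncrossing_interval_block:
  fixes \<pi> :: "nat set set"
  assumes dis: "blocks_disjoint \<pi>" and "\<pi> \<noteq> {}"
    and nc: "noncrossing \<pi>"
  shows "\<exists>V. interval_block \<pi> V"
proof -
  have blk: "finite V" "V \<noteq> {}" "Min V \<in> V" "Max V \<in> V" if "V \<in> \<pi>" for V
    using blocks_disjoint_block[OF dis that] by auto
  obtain V\<^sub>0 where "V\<^sub>0 \<in> \<pi>" using assms(2) by blast
  from ex_has_least_nat[of "\<lambda>V. V \<in> \<pi>", OF this, of "\<lambda>V. Max V - Min V"]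
  obtain V where V: "V \<in> \<pi>" and least: "\<And>W. W \<in> \<pi> \<Longrightarrow> Max V - Min V \<le> Max W - Min W"
    by blast
  have "s \<in> V" if "i \<in> V" "k \<in> V" "s \<in> \<Union>\<pi>" "i < s" "s < k" for i k s
  proof (rule ccontr)
    assume "s \<notin> V"
    then obtain W where W: "W \<in> \<pi>" "s \<in> W" "W \<noteq> V" using \<open>s \<in> \<Union>\<pi>\<close> by blast
    have "V \<inter> W = {}"
      using dis V W(1,3) unfolding blocks_disjoint_def disjoint_def by blast
    then have ne: "x \<noteq> y" if "x \<in> V" "y \<in> W" for x y
      using that by blast
    note blkW = blk[OF W(1)]
    have "\<not> Min W < i"
    proof
      assume "Min W < i"
      from noncrossingD[OF nc W(1) V this that(4,5) blkW(3) that(1) W(2) that(2)] W(3)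
      show False by simp
    qed
    moreover have "\<not> k < Max W"
    proof
      assume "k < Max W"
      from noncrossingD[OF nc V W(1) that(4,5) this that(1) W(2) that(2) blkW(4)] W(3)
      show False by simp
    qed
    moreover have "i \<noteq> Min W" "k \<noteq> Max W"
      by (rule ne[OF that(1) blkW(3)], rule ne[OF that(2) blkW(4)])
    moreover have "Min V \<le> i" "k \<le> Max V"
      using blk(1)[OF V] that by simp_all
    ultimately have 1: "Min V < Min W" and 2: "Max W < Max V"
      by linarith+
    have "Min W \<le> Max W" using blk[OF W(1)] by simp
    then show False using least[OF W(1)] 1 2 by linarith
  qed
  then show ?thesis unfolding interval_block_def using V by blast
qed

lemma Lambda_rel_exists:
  fixes \<pi> :: "nat set set"
  assumes "blocks_disjoint \<pi>"
    and "noncrossing \<pi>"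
  shows "\<exists>v. Lambda_rel Hs \<xi>s col \<pi> a v"
proof -
  have "finite \<pi>"
    using assms(1) by (simp add: blocks_disjoint_def finite_UnionD)
  then show ?thesis
    using assms
  proof (induction \<pi> arbitrary: a rule: finite_psubset_induct)
    case (psubset \<pi>)
    show ?case
    proof (cases "\<pi> = {}")
      case True
      then show ?thesis using Lambda_empty by blast
    next
      case False
      then obtain V where V: "interval_block \<pi> V"
        using noncrossing_interval_block psubset.prems by blast
      then have "\<pi> - {V} \<subset> \<pi>" unfolding interval_block_def by blast
      then have "\<exists>v. Lambda_rel Hs \<xi>s col (\<pi> - {V}) a' v" for a'
        using blocks_disjoint_remove[OF psubset.prems(1)] noncrossing_mono[OF psubset.prems(2)]
        by (intro psubset.IH) auto
      then obtain v where v: "\<And>a'. Lambda_rel Hs \<xi>s col (\<pi> - {V}) a' (v a')" by metis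
      show ?thesis
      proof (cases "{s \<in> \<Union>\<pi>. Max V < s} = {}")
        case True
        show ?thesis by (rule exI, rule Lambda_last[OF V True v])
      next
        case False
        show ?thesis by (rule exI, rule Lambda_inner[OF V False refl v])
      qed
    qed
  qed
qed

text \<open>Some derivation exists, and any two compute the output of the same run, so their values
  coincide. This justifies the definite description in \<open>Lambda\<close>.\<close>

lemma (in pointed_family) run_Lambda:
  assumes "\<pi> \<in> NC l col T"
    and "\<And>i. i \<in> {1..l} \<Longrightarrow> col i \<in> J \<and> modular (Hs (col i)) (a i)"
  shows "run_blocks col \<pi> a [1..<Suc l] = Some ([], Lambda Hs \<xi>s col \<pi> a)"
proof -
  have ncp: "\<pi> \<in> noncrossing_partitions {1..l}"
    and const: "\<And>V i j. V \<in> \<pi> \<Longrightarrow> i \<in> V \<Longrightarrow> j \<in> V \<Longrightarrow> col i = col j"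
    using assms(1) unfolding NC_def by blast+
  have U: "\<Union>\<pi> = {1..l}" and dis: "blocks_disjoint \<pi>" and nc: "noncrossing \<pi>"
    using ncp by (simp_all add: noncrossing_partitions_def noncrossing_def partition_on_def blocks_disjoint_def)
  have upt: "sorted_list_of_set {1..l} = [1..<Suc l]"
    by (metis atLeastLessThanSuc_atLeastAtMost sorted_list_of_set_range)
  have *: "run_blocks col \<pi> a [1..<Suc l] = Some ([], v)" if "Lambda_rel Hs \<xi>s col \<pi> a v" for v
    unfolding upt[symmetric] U[symmetric] using assms(2) U
    by (intro Lambda_rel_run[OF that dis]) (blast, rule const)
  obtain v where v: "Lambda_rel Hs \<xi>s col \<pi> a v"
    using Lambda_rel_exists[OF dis nc] by blast
  have "v' = v" if "Lambda_rel Hs \<xi>s col \<pi> a v'" for v'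
    using *[OF that] *[OF v] by simp
  then have "Lambda Hs \<xi>s col \<pi> a = v"
    unfolding Lambda_def using v by (intro the_equality)
  then show ?thesis using * v by simp
qed

section \<open>Building non-crossing partitions from right to left\<close>

text \<open>
  A state is a pair of the closed blocks and the stack of open blocks, innermost first. The maximum of a block does
  not change as the block grows to the left, so it serves to record the color of the block.
\<close>

fun nxt :: "(nat \<Rightarrow> nat) \<Rightarrow> nat list set \<Rightarrow> nat \<Rightarrow> nat set set \<times> nat set list \<Rightarrow> (nat set set \<times> nat set list) set"
  where
  "nxt col T i (C, st) =
    (if st \<noteq> [] \<and> col (Max (hd st)) = col i
     then {(C, insert i (hd st) # tl st), (insert (insert i (hd st)) C, tl st)}
     else if col i # map (col \<circ> Max) st \<in> T then {(insert {i} C, st), (C, {i} # st)} else {})"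

fun states :: "(nat \<Rightarrow> nat) \<Rightarrow> nat list set \<Rightarrow> nat list \<Rightarrow> (nat set set \<times> nat set list) set" where
  "states col T [] = {({}, [])}"
| "states col T (i # is) = (\<Union>S\<in>states col T is. nxt col T i S)"

section \<open>Partial non-crossing partitions with open blocks\<close>

definition base :: "('i \<Rightarrow> 'c) \<Rightarrow> 'i::linorder set \<Rightarrow> 'i set set \<Rightarrow> bool" where
  "base col X P \<longleftrightarrow> partition_on X P \<and> noncrossing P \<and> (\<forall>V\<in>P. \<forall>x\<in>V. \<forall>y\<in>V. col x = col y)"

text \<open>An open block must still receive a letter further left. If it had a point between two
  points of a closed block, that letter would complete a crossing.\<close>

definition outer :: "'i::linorder set set \<Rightarrow> 'i set \<Rightarrow> bool" where
  "outer C V \<longleftrightarrow> (\<forall>W\<in>C. \<forall>a\<in>W. \<forall>b\<in>V. \<forall>c\<in>W. \<not> (a < b \<and> b < c))"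

text \<open>The order of the open blocks: an outer one receives no letter while an inner one is
  open, so in the part already read the inner one lies entirely to the left.\<close>

definition block_less :: "'i::linorder set \<Rightarrow> 'i set \<Rightarrow> bool" where
  "block_less V W \<longleftrightarrow> (\<forall>x\<in>V. \<forall>y\<in>W. x < y)"

text \<open>
  An open block will surround every block lying below its maximum once it is completed, so it counts as nesting
  already now.
\<close>

definition maxima :: "'i::linorder set set \<Rightarrow> 'i set set \<Rightarrow> 'i set \<Rightarrow> 'i set" where
  "maxima C Op V = insert (Max V) (Max ` {W\<in>C. nested_in V W} \<union> Max ` {W\<in>Op. Max V < Max W})"

text \<open>A description of the reachable states that does not mention how they were reached. As
  \<open>base\<close> sees only the union of closed and open blocks, their separation is a clause of
  its own; that the stack has no repetitions follows from \<open>block_less\<close>.\<close>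

definition admissible :: "('i \<Rightarrow> 'c) \<Rightarrow> 'c list set \<Rightarrow> 'i::linorder set \<Rightarrow> 'i set set \<Rightarrow> 'i set list \<Rightarrow> bool" where
  "admissible col T X C st \<longleftrightarrow> base col X (C \<union> set st) \<and> C \<inter> set st = {} \<and> sorted_wrt block_less st \<and>
     (\<forall>V\<in>set st. outer C V) \<and>
     (\<forall>V\<in>C \<union> set st. map col (sorted_list_of_set (maxima C (set st) V)) \<in> T)"

lemma baseD:
  assumes "base col X P"
  shows "\<Union>P = X" "{} \<notin> P" "noncrossing P"
    "\<And>V W. V \<in> P \<Longrightarrow> W \<in> P \<Longrightarrow> x \<in> V \<Longrightarrow> x \<in> W \<Longrightarrow> V = W"
    "\<And>V x y. V \<in> P \<Longrightarrow> x \<in> V \<Longrightarrow> y \<in> V \<Longrightarrow> col x = col y"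
  using assms unfolding base_def partition_on_def disjoint_def by blast+

lemma baseI:
  assumes "\<Union>P = X" "{} \<notin> P"
    "\<And>V W x. V \<in> P \<Longrightarrow> W \<in> P \<Longrightarrow> x \<in> V \<Longrightarrow> x \<in> W \<Longrightarrow> V = W"
    "\<And>V W a b c d. \<lbrakk>V \<in> P; W \<in> P; a < b; b < c; c < d; a \<in> V; b \<in> W; c \<in> V; d \<in> W\<rbrakk> \<Longrightarrow> V = W"
    "\<And>V x y. V \<in> P \<Longrightarrow> x \<in> V \<Longrightarrow> y \<in> V \<Longrightarrow> col x = col y"
  shows "base col X P"
proof -
  have "disjoint P" unfolding disjoint_def using assms(3) by blast
  moreover have "noncrossing P" unfolding noncrossing_def using assms(4) by metis
  ultimately show ?thesis
    unfolding base_def partition_on_def using assms(1,2,5) by blast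
qed

lemma base_insert_singleton:
  assumes "base col X P" "i \<notin> X"
  shows "base col (insert i X) (insert {i} P)"
proof (rule baseI)
  note B = baseD[OF assms(1)]
  show "\<Union>(insert {i} P) = insert i X" "{} \<notin> insert {i} P"
    using B(1,2) by auto
  have i: "i \<notin> V" if "V \<in> P" for V using that B(1) assms(2) by blast
  show "V = W" if "V \<in> insert {i} P" "W \<in> insert {i} P" "x \<in> V" "x \<in> W" for V W x
    using that i B(4) by blast
  show "col x = col y" if "V \<in> insert {i} P" "x \<in> V" "y \<in> V" for V x y
    using that B(5) by blast
  show "V = W" if "V \<in> insert {i} P" "W \<in> insert {i} P" "a < b" "b < c" "c < d" "a \<in> V" "b \<in> W" "c \<in> V" "d \<in> W"
    for V W a b c d
  proof -
    have "V \<noteq> {i}" "W \<noteq> {i}" using that(3-9) by auto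
    then show ?thesis using noncrossingD[OF B(3) _ _ that(3-9)] that(1,2) by blast
  qed
qed

lemma base_remove_singleton:
  assumes "base col (insert i X) (insert {i} P)" "{i} \<notin> P" "i \<notin> X"
  shows "base col X P"
proof (rule baseI)
  note B = baseD[OF assms(1)]
  have "i \<notin> V" if "V \<in> P" for V using that B(4)[of V "{i}" i] assms(2) by blast
  then have "i \<notin> \<Union>P" by blast
  moreover have "insert i (\<Union>P) = insert i X" using B(1) by simp
  ultimately show "\<Union>P = X" using assms(3) by (simp add: insert_ident)
  show "{} \<notin> P" using B(2) by blast
  show "V = W" if "V \<in> P" "W \<in> P" "x \<in> V" "x \<in> W" for V W x
    using that B(4) by blast
  show "col x = col y" if "V \<in> P" "x \<in> V" "y \<in> V" for V x y
    using that B(5) by blast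
  show "V = W" if "V \<in> P" "W \<in> P" "a < b" "b < c" "c < d" "a \<in> V" "b \<in> W" "c \<in> V" "d \<in> W"
    for V W a b c d
    using noncrossingD[OF B(3) _ _ that(3-9)] that(1,2) by blast
qed

text \<open>In a crossing, i can only be the first point. If the extended block comes first, the
  other three points contradict \<open>outer\<close>; otherwise the crossing does not involve i and
  is an old one.\<close>

lemma base_extend_block:
  assumes "base col X (insert V P)" "V \<notin> P" "outer P V" "\<And>x. x \<in> X \<Longrightarrow> i < x" "v \<in> V" "col v = col i"
  shows "base col (insert i X) (insert (insert i V) P)"
proof (rule baseI)
  note B = baseD[OF assms(1)]
  have less: "i < x" if "U \<in> insert V P" "x \<in> U" for U x using that B(1) assms(4) by blast
  then have i: "i \<notin> U" if "U \<in> insert V P" for U using that by blast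
  have VP: "U = V" if "U \<in> P" "x \<in> U" "x \<in> V" for U x using that B(4) by blast
  show "\<Union>(insert (insert i V) P) = insert i X" "{} \<notin> insert (insert i V) P"
    using B(1,2) by auto
  show "U = W" if "U \<in> insert (insert i V) P" "W \<in> insert (insert i V) P" "x \<in> U" "x \<in> W" for U W x
  proof -
    note h = that
    consider "U = insert i V" "W = insert i V" | "U \<in> P" | "W \<in> P" using h(1,2) by blast
    then show ?thesis
    proof cases
      case 2
      then have "x \<noteq> i" using i[of U] that(3) by blast
      then show ?thesis using 2 VP[of U x] B(4)[of U W x] that assms(2) by auto
    next
      case 3
      then have "x \<noteq> i" using i[of W] that(4) by blast
      then show ?thesis using 3 VP[of W x] B(4)[of U W x] that assms(2) by auto
    qed simp
  qed
  have cv: "col x = col i" if "x \<in> insert i V" for x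
    using that B(5)[of V x v] assms(5,6) by auto
  show "col x = col y" if "U \<in> insert (insert i V) P" "x \<in> U" "y \<in> U" for U x y
    using that B(5)[of U x y] cv[of x] cv[of y] by auto
  show "U = W" if "U \<in> insert (insert i V) P" "W \<in> insert (insert i V) P" "a < b" "b < c" "c < d" "a \<in> U" "b \<in> W" "c \<in> U" "d \<in> W"
    for U W a b c d
  proof (rule ccontr)
    assume ne: "U \<noteq> W"
    note h = that
    have gt: "i \<le> x" if "x \<in> R" "R \<in> insert (insert i V) P" for x R
      using that less by fastforce
    have nei: "b \<noteq> i" "c \<noteq> i" "d \<noteq> i"
      using gt[OF h(6,1)] h(3-5) by auto
    consider "U = insert i V" "W \<in> P" | "U \<in> P" "W = insert i V" | "U \<in> P" "W \<in> P"
      using h(1,2) ne by blast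
    then show False
    proof cases
      case 1
      then show False
        using assms(3) h(4,5,7-9) nei unfolding outer_def by blast
    next
      case 2
      then have "b \<in> V" "d \<in> V" using h nei by auto
      then show False using noncrossingD[OF B(3) _ _ h(3-6) _ h(8), of V] 2 assms(2) by blast
    next
      case 3
      then show False using noncrossingD[OF B(3) _ _ h(3-9)] ne by blast
    qed
  qed
qed

lemma base_shrink_block:
  assumes "base col (insert i X) (insert (insert i V) P)" "insert i V \<notin> P" "i \<notin> X" "i \<notin> V" "V \<noteq> {}"
  shows "base col X (insert V P)" "V \<notin> P"
proof -
  note B = baseD[OF assms(1)]
  have dis: "x \<notin> insert i V" if "U \<in> P" "x \<in> U" for U x using that B(4)[of U "insert i V" x] assms(2) by blast
  then show "V \<notin> P" using assms(5) by blast
  show "base col X (insert V P)"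
  proof (rule baseI)
    have "i \<notin> \<Union>(insert V P)" using dis assms(4) by blast
    moreover have "insert i (\<Union>(insert V P)) = insert i X" using B(1) by simp
    ultimately show "\<Union>(insert V P) = X" using assms(3) by (simp add: insert_ident)
    show "{} \<notin> insert V P" using B(2) assms(5) by blast
    show "U = W" if "U \<in> insert V P" "W \<in> insert V P" "x \<in> U" "x \<in> W" for U W x
      using that dis B(4) by blast
    show "col x = col y" if "U \<in> insert V P" "x \<in> U" "y \<in> U" for U x y
      using that B(5)[of "insert i V" x y] B(5)[of U x y] by blast
    show "U = W" if "U \<in> insert V P" "W \<in> insert V P" "a < b" "b < c" "c < d" "a \<in> U" "b \<in> W" "c \<in> U" "d \<in> W"
      for U W a b c d
    proof (rule ccontr)
      assume ne: "U \<noteq> W"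
      note h = that
    note h = that
      consider "U = V" "W \<in> P" | "U \<in> P" "W = V" | "U \<in> P" "W \<in> P"
        using h(1,2) ne by blast
      then show False
      proof cases
        case 1
        then show False
          using noncrossingD[OF B(3) _ _ h(3-5), of "insert i V" W] h(6-9) assms(2) by blast
      next
        case 2
        then show False
          using noncrossingD[OF B(3) _ _ h(3-5), of U "insert i V"] h(6-9) assms(2) by blast
      next
        case 3
        then show False using noncrossingD[OF B(3) _ _ h(3-9)] ne by blast
      qed
    qed
  qed
qed

lemma base_finite_block: "base col X P \<Longrightarrow> finite X \<Longrightarrow> V \<in> P \<Longrightarrow> finite V \<and> V \<noteq> {} \<and> V \<subseteq> X"
  unfolding base_def partition_on_def by (metis Union_upper finite_subset)

lemma nested_in_greater:
  assumes "nested_in V W" "x \<in> V"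
  shows "\<exists>j\<in>W. j < x"
  using assms unfolding nested_in_def by blast

lemma image_filter_insert:
  "f ` {W \<in> insert A S. Q W} = (if Q A then insert (f A) (f ` {W \<in> S. Q W}) else f ` {W \<in> S. Q W})"
  by auto

text \<open>Innermost first is also the increasing order of the maxima. Sorting the set of maxima
  therefore recovers the stack, and its colors form the string tested in \<open>nxt\<close>.\<close>

lemma sorted_maxima:
  fixes i :: "'i::linorder"
  assumes "sorted_wrt block_less st" "\<And>V. V \<in> set st \<Longrightarrow> finite V \<and> V \<noteq> {} \<and> (\<forall>x\<in>V. i < x)"
  shows "sorted_list_of_set (insert i (Max ` set st)) = i # map Max st"
proof (rule strict_sorted_equal)
  show "sorted_wrt (<) (i # map Max st)"
    using assms
  proof (induction st)
    case (Cons V st)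
    have V: "Max V \<in> V" using Cons.prems(2)[of V] by simp
    then have "i < Max V" using Cons.prems(2)[of V] by simp
    moreover have "Max V < Max W" if "W \<in> set st" for W
    proof -
      have "Max W \<in> W" using Cons.prems(2)[of W] that by simp
      then show ?thesis using Cons.prems(1) that V by (simp add: block_less_def)
    qed
    moreover have "sorted_wrt (<) (i # map Max st)"
      using Cons.prems(1) by (intro Cons.IH Cons.prems(2)) simp_all
    ultimately show ?case by simp
  qed simp
qed (simp_all del: sorted_list_of_set_insert_remove)

section \<open>Adding a new least element to an admissible state\<close>

context
  fixes X :: "'i::linorder set" and i :: 'i
  assumes fin: "finite X" and less: "x \<in> X \<Longrightarrow> i < x"
begin

text \<open>No closed block reaches below the new least point, so none encloses it, whereas every
  open block counts as enclosing it. This is why its string is the full stack.\<close>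

lemma maxima_new:
  assumes "base col X (C \<union> set st)" "sorted_wrt block_less st" "Op = set st \<or> Op = insert {i} (set st)"
    and "C' = C \<or> C' = insert {i} C"
  shows "maxima C' Op {i} = insert i (Max ` set st)"
proof -
  have "\<not> nested_in {i} W" if "W \<in> C'" for W
  proof
    assume "nested_in {i} W"
    from nested_in_greater[OF this, of i] obtain j where j: "j \<in> W" "j < i" by auto
    then have "W \<in> C" using that assms(4) by auto
    then have "j \<in> X" using base_finite_block[OF assms(1) fin, of W] j(1) by blast
    from less[OF this] j(2) show False by simp
  qed
  moreover have "i < Max W" if "W \<in> set st" for W
    using that base_finite_block[OF assms(1) fin, of W] less by (meson Max_in UnI2 subsetD)
  ultimately show ?thesis
    unfolding maxima_def using assms(3) by auto
qed

lemma maxima_old: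
  assumes "U \<noteq> {}" "U \<subseteq> X"
  shows "maxima (insert {i} C) Op U = maxima C Op U" "maxima C (insert {i} Op) U = maxima C Op U"
proof -
  have "finite U" using assms(2) fin finite_subset by blast
  then have "\<not> Max U < i" using assms less Max_in by (metis order.asym subsetD)
  moreover have "\<not> nested_in U {i}" using assms unfolding nested_in_def by auto
  ultimately show "maxima (insert {i} C) Op U = maxima C Op U" "maxima C (insert {i} Op) U = maxima C Op U"
    by (auto simp: maxima_def)
qed

text \<open>This and the three other transitions (closed singleton, extension, closing) are each
  treated as an equivalence, so that the same facts show that reachable states are admissible and
  that admissible states are reachable.\<close>

lemma admissible_open:
  "admissible col T (insert i X) C ({i} # st) \<longleftrightarrow>
     admissible col T X C st \<and> col i # map (col \<circ> Max) st \<in> T"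
proof -
  have iX: "i \<notin> X" using less by blast
  \<comment> \<open>Comparing the remaining clauses needs the blocks to be nonempty subsets of X.
    The partition clauses are therefore assumed here and supplied afterwards, by adding or removing
    the singleton.\<close>
  have main: "admissible col T (insert i X) C ({i} # st) \<longleftrightarrow>
      admissible col T X C st \<and> col i # map (col \<circ> Max) st \<in> T"
    if b: "base col X (C \<union> set st)" and b': "base col (insert i X) (C \<union> set ({i} # st))"
  proof (cases "sorted_wrt block_less st")
    case True
    have blk: "finite U \<and> U \<noteq> {} \<and> U \<subseteq> X" if "U \<in> C \<union> set st" for U
      by (rule base_finite_block[OF b fin that])
    have "maxima C (set ({i} # st)) {i} = insert i (Max ` set st)"
      by (rule maxima_new[OF b True]) auto
    moreover have "sorted_list_of_set (insert i (Max ` set st)) = i # map Max st"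
      by (rule sorted_maxima[OF True]) (use blk less in blast)
    ultimately have "sorted_list_of_set (maxima C (set ({i} # st)) {i}) = i # map Max st"
      by simp
    moreover have "maxima C (set ({i} # st)) U = maxima C (set st) U" if "U \<in> C \<union> set st" for U
      using maxima_old(2)[of U C "set st"] blk[OF that] by simp
    moreover have "{i} \<notin> C" using blk iX by blast
    moreover have "block_less {i} U" if "U \<in> set st" for U
      using blk[of U] that less unfolding block_less_def by blast
    moreover have "outer C {i}"
      unfolding outer_def
    proof (intro ballI notI)
      fix W x y z assume "W \<in> C" "x \<in> W" "y \<in> {i}" "z \<in> W" "x < y \<and> y < z"
      then have "x \<in> X" "x < i" using blk by blast+
      with less show False by fastforce
    qed
    ultimately show ?thesis
      unfolding admissible_def using b b' True by (auto simp: comp_def)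
  qed (auto simp: admissible_def)
  show ?thesis
  proof
    assume A: "admissible col T (insert i X) C ({i} # st)"
    then have b': "base col (insert i X) (insert {i} (C \<union> set st))" and "C \<inter> set ({i} # st) = {}"
      "sorted_wrt block_less ({i} # st)"
      unfolding admissible_def by simp_all
    then have "{i} \<notin> C \<union> set st" by (auto simp: block_less_def)
    then have "base col X (C \<union> set st)" by (rule base_remove_singleton[OF b' _ iX])
    then show "admissible col T X C st \<and> col i # map (col \<circ> Max) st \<in> T"
      using main A b' by simp
  next
    assume A: "admissible col T X C st \<and> col i # map (col \<circ> Max) st \<in> T"
    then have b: "base col X (C \<union> set st)" by (simp add: admissible_def)
    from base_insert_singleton[OF b iX] show "admissible col T (insert i X) C ({i} # st)"
      using main[OF b] A by simp
  qed
qed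

lemma admissible_singleton:
  assumes "{i} \<notin> C"
  shows "admissible col T (insert i X) (insert {i} C) st \<longleftrightarrow>
     admissible col T X C st \<and> col i # map (col \<circ> Max) st \<in> T"
proof -
  have iX: "i \<notin> X" using less by blast
  have main: "admissible col T (insert i X) (insert {i} C) st \<longleftrightarrow>
      admissible col T X C st \<and> col i # map (col \<circ> Max) st \<in> T"
    if b: "base col X (C \<union> set st)" and b': "base col (insert i X) (insert {i} C \<union> set st)"
  proof (cases "sorted_wrt block_less st")
    case True
    have blk: "finite U \<and> U \<noteq> {} \<and> U \<subseteq> X" if "U \<in> C \<union> set st" for U
      by (rule base_finite_block[OF b fin that])
    have "maxima (insert {i} C) (set st) {i} = insert i (Max ` set st)"
      by (rule maxima_new[OF b True]) auto
    moreover have "sorted_list_of_set (insert i (Max ` set st)) = i # map Max st"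
      by (rule sorted_maxima[OF True]) (use blk less in blast)
    ultimately have "sorted_list_of_set (maxima (insert {i} C) (set st) {i}) = i # map Max st"
      by simp
    moreover have "maxima (insert {i} C) (set st) U = maxima C (set st) U" if "U \<in> C \<union> set st" for U
      using maxima_old(1)[of U C "set st"] blk[OF that] by simp
    moreover have "{i} \<notin> set st" using blk iX by blast
    moreover have "outer (insert {i} C) U \<longleftrightarrow> outer C U" for U
      unfolding outer_def by auto
    ultimately show ?thesis
      unfolding admissible_def using b b' True by (auto simp: comp_def)
  qed (auto simp: admissible_def)
  show ?thesis
  proof
    assume A: "admissible col T (insert i X) (insert {i} C) st"
    then have b': "base col (insert i X) (insert {i} (C \<union> set st))" and "insert {i} C \<inter> set st = {}"
      unfolding admissible_def by simp_all
    then have "{i} \<notin> C \<union> set st" using assms by blast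
    then have "base col X (C \<union> set st)" by (rule base_remove_singleton[OF b' _ iX])
    then show "admissible col T X C st \<and> col i # map (col \<circ> Max) st \<in> T"
      using main A b' by simp
  next
    assume A: "admissible col T X C st \<and> col i # map (col \<circ> Max) st \<in> T"
    then have b: "base col X (C \<union> set st)" by (simp add: admissible_def)
    from base_insert_singleton[OF b iX] show "admissible col T (insert i X) (insert {i} C) st"
      using main[OF b] A by simp
  qed
qed

context
  fixes V :: "'i set" and C :: "'i set set" and st :: "'i set list"
  assumes V: "V \<noteq> {}" "V \<subseteq> X" and blk: "U \<in> C \<union> set st \<Longrightarrow> U \<noteq> {} \<and> U \<subseteq> X"
    and out: "outer C V"
begin

lemma finV: "finite V" using V(2) fin finite_subset by blast

lemma Max_insert_i: "Max (insert i V) = Max V"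
proof -
  have "i \<le> Max V" using V less Max_in[OF finV] by (metis order.strict_implies_order subsetD)
  then show ?thesis using finV V(1) by (simp add: max_absorb2)
qed

lemma not_nested:
  assumes "W \<in> C"
  shows "\<not> nested_in V W" "\<not> nested_in (insert i V) W"
proof -
  show "\<not> nested_in V W"
    using assms out V(1) unfolding nested_in_def outer_def by blast
  show "\<not> nested_in (insert i V) W"
    using nested_in_greater[of "insert i V" W i] assms blk[of W] less by fastforce
qed

text \<open>As i lies below everything, nesting inside the extended block only depends on the right
  ends. This is why \<open>maxima\<close> may count open blocks by comparing maxima: closing a block
  then changes nothing.\<close>

lemma nested_in_insert_i:
  assumes "U \<in> C \<union> set st"
  shows "nested_in U (insert i V) \<longleftrightarrow> Max U < Max V"
proof -
  have U: "finite U" "U \<noteq> {}" "U \<subseteq> X" using blk[OF assms] fin finite_subset by auto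
  have lessU: "i < u" if "u \<in> U" for u using that U(3) less by blast
  show ?thesis
  proof
    assume "nested_in U (insert i V)"
    then obtain k where k: "k \<in> insert i V" "\<forall>u\<in>U. u < k" unfolding nested_in_def by blast
    have "Max U < k" using k(2) U by simp
    moreover have "k \<noteq> i" using k(2) lessU U(2) by fastforce
    ultimately show "Max U < Max V" using k(1) Max_ge[OF finV, of k] by auto
  next
    assume "Max U < Max V"
    then have "i < u \<and> u < Max V" if "u \<in> U" for u
      using that lessU Max_ge[OF U(1) that] by auto
    moreover have "Max V \<in> V" using Max_in[OF finV V(1)] .
    ultimately show "nested_in U (insert i V)" unfolding nested_in_def by blast
  qed
qed

text \<open>The maximum of V does not move, and once i is added V encloses exactly the blocks with
  smaller maximum. So neither extending nor closing V alters the string of any block, and no new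
  test against T arises.\<close>

lemma maxima_extend:
  "maxima C (insert (insert i V) (set st)) (insert i V) = maxima C (insert V (set st)) V"
  "maxima (insert (insert i V) C) (set st) (insert i V) = maxima C (insert V (set st)) V"
  "U \<in> C \<union> set st \<Longrightarrow> maxima C (insert (insert i V) (set st)) U = maxima C (insert V (set st)) U"
  "U \<in> C \<union> set st \<Longrightarrow> maxima (insert (insert i V) C) (set st) U = maxima C (insert V (set st)) U"
proof -
  have self: "\<not> nested_in W W" for W :: "'i set" unfolding nested_in_def by blast
  show "maxima C (insert (insert i V) (set st)) (insert i V) = maxima C (insert V (set st)) V"
    using not_nested by (auto simp: maxima_def Max_insert_i)
  show "maxima (insert (insert i V) C) (set st) (insert i V) = maxima C (insert V (set st)) V"
    using not_nested self by (auto simp: maxima_def Max_insert_i)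
  show "maxima C (insert (insert i V) (set st)) U = maxima C (insert V (set st)) U" if "U \<in> C \<union> set st"
  proof -
    have "Max ` {W \<in> insert (insert i V) (set st). Max U < Max W} = Max ` {W \<in> insert V (set st). Max U < Max W}"
      by (simp only: image_filter_insert Max_insert_i)
    then show ?thesis by (simp add: maxima_def)
  qed
  show "maxima (insert (insert i V) C) (set st) U = maxima C (insert V (set st)) U" if "U \<in> C \<union> set st"
    unfolding maxima_def image_filter_insert Max_insert_i nested_in_insert_i[OF that]
    by (cases "Max U < Max V") auto
qed

end

lemma admissible_extend:
  assumes "V \<noteq> {}" "i \<notin> V"
  shows "admissible col T (insert i X) C (insert i V # st) \<longleftrightarrow>
     admissible col T X C (V # st) \<and> col (Max V) = col i"
proof -
  have iX: "i \<notin> X" using less by blast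
  show ?thesis
  proof
    assume A: "admissible col T (insert i X) C (insert i V # st)"
    then have b': "base col (insert i X) (insert (insert i V) (C \<union> set st))"
      and c': "C \<inter> set (insert i V # st) = {}"
      and s: "sorted_wrt block_less (insert i V # st)" and o: "\<forall>U\<in>set (insert i V # st). outer C U"
      and t: "\<forall>U\<in>C \<union> set (insert i V # st). map col (sorted_list_of_set (maxima C (set (insert i V # st)) U)) \<in> T"
      unfolding admissible_def by simp_all
    have "insert i V \<notin> C \<union> set st" using c' s by (auto simp: block_less_def)
    note b = base_shrink_block[OF b' this iX assms(2,1)]
    have blk: "U \<noteq> {} \<and> U \<subseteq> X" if "U \<in> insert V (C \<union> set st)" for U
      using base_finite_block[OF b(1) fin that] by simp
    have V: "V \<subseteq> X" using blk by blast
    have oV: "outer C V" using o unfolding outer_def by simp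
    have fV: "finite V" using V fin finite_subset by blast
    have "col (Max V) = col i"
      using baseD(5)[OF b', of "insert i V" "Max V" i] Max_in[OF fV assms(1)] by simp
    moreover have "sorted_wrt block_less (V # st)" using s by (simp add: block_less_def)
    moreover have "C \<inter> set (V # st) = {}" using c' b(2) by auto
    moreover have "\<forall>U\<in>C \<union> set (V # st). map col (sorted_list_of_set (maxima C (set (V # st)) U)) \<in> T"
      using t maxima_extend(1,3)[OF assms(1) V _ oV, of st] blk by simp
    ultimately show "admissible col T X C (V # st) \<and> col (Max V) = col i"
      unfolding admissible_def using b(1) o oV by simp
  next
    assume A: "admissible col T X C (V # st) \<and> col (Max V) = col i"
    then have b: "base col X (insert V (C \<union> set st))"
      and c: "C \<inter> set (V # st) = {}"
      and s: "sorted_wrt block_less (V # st)" and o: "\<forall>U\<in>set (V # st). outer C U"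
      and t: "\<forall>U\<in>C \<union> set (V # st). map col (sorted_list_of_set (maxima C (set (V # st)) U)) \<in> T"
      unfolding admissible_def by simp_all
    have blk: "U \<noteq> {} \<and> U \<subseteq> X" if "U \<in> insert V (C \<union> set st)" for U
      using base_finite_block[OF b fin that] by simp
    have V: "V \<subseteq> X" using blk by blast
    have oV: "outer C V" using o by simp
    have fV: "finite V" using V fin finite_subset by blast
    have sV: "\<forall>U\<in>set st. block_less V U" using s by simp
    have nin: "V \<notin> C \<union> set st" using c sV assms(1) by (auto simp: block_less_def)
    have "outer (C \<union> set st) V"
      using oV sV unfolding outer_def block_less_def by (meson Un_iff order.asym)
    then have b': "base col (insert i X) (insert (insert i V) (C \<union> set st))"
      using A Max_in[OF fV assms(1)] by (intro base_extend_block[where v = "Max V", OF b nin _ less]) auto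
    have iU: "i < u" if "u \<in> U" "U \<in> C \<union> set st" for u U
      using that blk less by blast
    have "sorted_wrt block_less (insert i V # st)"
      using s iU by (auto simp: block_less_def)
    moreover have "C \<inter> set (insert i V # st) = {}" using c iU[of i "insert i V"] by auto
    moreover have "\<forall>U\<in>C \<union> set (insert i V # st). map col (sorted_list_of_set (maxima C (set (insert i V # st)) U)) \<in> T"
      using t maxima_extend(1,3)[OF assms(1) V _ oV, of st] blk by simp
    moreover have "outer C (insert i V)"
      using oV iU unfolding outer_def by (metis UnI1 insert_iff order.asym)
    ultimately show "admissible col T (insert i X) C (insert i V # st)"
      unfolding admissible_def using b' o by simp
  qed
qed

lemma admissible_close:
  assumes "V \<noteq> {}" "i \<notin> V" "insert i V \<notin> C"
  shows "admissible col T (insert i X) (insert (insert i V) C) st \<longleftrightarrow>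
     admissible col T X C (V # st) \<and> col (Max V) = col i"
proof -
  have iX: "i \<notin> X" using less by blast
  show ?thesis
  proof
    assume A: "admissible col T (insert i X) (insert (insert i V) C) st"
    then have b': "base col (insert i X) (insert (insert i V) (C \<union> set st))"
      and c': "insert (insert i V) C \<inter> set st = {}"
      and s: "sorted_wrt block_less st" and o: "\<forall>U\<in>set st. outer (insert (insert i V) C) U"
      and t: "\<forall>U\<in>insert (insert i V) C \<union> set st.
        map col (sorted_list_of_set (maxima (insert (insert i V) C) (set st) U)) \<in> T"
      unfolding admissible_def by simp_all
    have nin: "insert i V \<notin> C \<union> set st" using c' assms(3) by auto
    note b = base_shrink_block[OF b' nin iX assms(2,1)]
    have blk: "U \<noteq> {} \<and> U \<subseteq> X" if "U \<in> insert V (C \<union> set st)" for U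
      using base_finite_block[OF b(1) fin that] by simp
    have V: "V \<subseteq> X" using blk by blast
    have fV: "finite V" using V fin finite_subset by blast
    have iU: "i < u" if "u \<in> U" "U \<in> C \<union> set st" for u U
      using that blk less by blast
    \<comment> \<open>A point y of V between x and z of a closed block, together with i in the block
      of V, gives the crossing i < x < y < z.\<close>
    have oV: "outer C V"
      unfolding outer_def
    proof (intro ballI notI)
      fix W x y z assume "W \<in> C" "x \<in> W" "y \<in> V" "z \<in> W" "x < y \<and> y < z"
      then show False
        using noncrossingD[OF baseD(3)[OF b'], of "insert i V" W i x y z] iU[of x W] assms(3) by blast
    qed
    have "col (Max V) = col i"
      using baseD(5)[OF b', of "insert i V" "Max V" i] Max_in[OF fV assms(1)] by simp
    \<comment> \<open>If u lay below v, then i < u < v would place a point of the open block U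
      between two points of the newly closed block.\<close>
    moreover have "block_less V U" if "U \<in> set st" for U
      unfolding block_less_def
    proof (intro ballI)
      fix v u assume vu: "v \<in> V" "u \<in> U"
      have "outer (insert (insert i V) C) U" using o that by blast
      from this[unfolded outer_def, rule_format, of "insert i V" i u v] vu
      have "\<not> (i < u \<and> u < v)" by simp
      moreover have "u \<noteq> v"
      proof
        assume "u = v"
        with vu have "u \<in> U" "u \<in> V" by simp_all
        then have "U = V" by (rule baseD(4)[OF b(1), rotated 2]) (simp_all add: that)
        then show False using that b(2) by simp
      qed
      ultimately show "v < u" using iU[OF vu(2)] that by auto
    qed
    then have "sorted_wrt block_less (V # st)" using s by simp
    moreover have "C \<inter> set (V # st) = {}" using c' b(2) by auto
    moreover have "\<forall>U\<in>C \<union> set (V # st). map col (sorted_list_of_set (maxima C (set (V # st)) U)) \<in> T"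
      using t maxima_extend(2,4)[OF assms(1) V _ oV, of st] blk by simp
    moreover have "\<forall>U\<in>set (V # st). outer C U"
      using o oV unfolding outer_def by simp
    ultimately show "admissible col T X C (V # st) \<and> col (Max V) = col i"
      unfolding admissible_def using b(1) by simp
  next
    assume A: "admissible col T X C (V # st) \<and> col (Max V) = col i"
    then have b: "base col X (insert V (C \<union> set st))"
      and c: "C \<inter> set (V # st) = {}"
      and s: "sorted_wrt block_less (V # st)" and o: "\<forall>U\<in>set (V # st). outer C U"
      and t: "\<forall>U\<in>C \<union> set (V # st). map col (sorted_list_of_set (maxima C (set (V # st)) U)) \<in> T"
      unfolding admissible_def by simp_all
    have blk: "U \<noteq> {} \<and> U \<subseteq> X" if "U \<in> insert V (C \<union> set st)" for U
      using base_finite_block[OF b fin that] by simp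
    have V: "V \<subseteq> X" using blk by blast
    have oV: "outer C V" using o by simp
    have fV: "finite V" using V fin finite_subset by blast
    have sV: "\<forall>U\<in>set st. block_less V U" using s by simp
    have nin: "V \<notin> C \<union> set st" using c sV assms(1) by (auto simp: block_less_def)
    have "outer (C \<union> set st) V"
      using oV sV unfolding outer_def block_less_def by (meson Un_iff order.asym)
    then have b': "base col (insert i X) (insert (insert i V) (C \<union> set st))"
      using A Max_in[OF fV assms(1)] by (intro base_extend_block[where v = "Max V", OF b nin _ less]) auto
    have iU: "i < u" if "u \<in> U" "U \<in> C \<union> set st" for u U
      using that blk less by blast
    have "insert (insert i V) C \<inter> set st = {}" using c iU[of i "insert i V"] by auto
    moreover have "\<forall>U\<in>insert (insert i V) C \<union> set st.
        map col (sorted_list_of_set (maxima (insert (insert i V) C) (set st) U)) \<in> T"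
      using t maxima_extend(2,4)[OF assms(1) V _ oV, of st] blk by simp
    moreover have "outer (insert (insert i V) C) U" if "U \<in> set st" for U
    proof -
      have "v < u" if "v \<in> insert i V" "u \<in> U" for u v
        using that sV iU[OF that(2)] \<open>U \<in> set st\<close> unfolding block_less_def by auto
      then show ?thesis
        using o that unfolding outer_def by (metis insert_iff list.set_intros(2) order.asym)
    qed
    ultimately show "admissible col T (insert i X) (insert (insert i V) C) st"
      unfolding admissible_def using b' s by simp
  qed
qed

end

section \<open>Reachable states are the admissible ones\<close>

lemma alternating_hd_color:
  assumes T: "\<And>s. s \<in> T \<Longrightarrow> distinct_adj s" and "col i # map (col \<circ> Max) st \<in> T"
  shows "\<not> (st \<noteq> [] \<and> col (Max (hd st)) = col i)"
  using T[OF assms(2)] by (cases st) auto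

text \<open>The block of the least letter tells which transition came last. If it is open it must be
  on top of the stack, since deeper blocks lie to the right of the top one.\<close>

lemma block_of_least:
  fixes X :: "'i::linorder set"
  assumes adm: "admissible col T (insert i X) C st" and less: "\<And>x. x \<in> X \<Longrightarrow> i < x"
  obtains r where "st = {i} # r"
  | V r where "st = insert i V # r" "V \<noteq> {}" "i \<notin> V"
  | C' where "C = insert {i} C'" "{i} \<notin> C'"
  | V C' where "C = insert (insert i V) C'" "V \<noteq> {}" "i \<notin> V" "insert i V \<notin> C'"
proof -
  have b: "base col (insert i X) (C \<union> set st)" and s: "sorted_wrt block_less st"
    using adm unfolding admissible_def by simp_all
  have ge: "i \<le> x" if "x \<in> U" "U \<in> C \<union> set st" for x U
    using that baseD(1)[OF b] less by (metis UnionI insertE order.refl order.strict_implies_order)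
  obtain B where B: "B \<in> C \<union> set st" "i \<in> B"
    using baseD(1)[OF b] by blast
  have Bi: "B = insert i (B - {i})" using B(2) by blast
  show thesis
  proof (cases "B \<in> set st")
    case True
    then obtain U r where st: "st = U # r" by (cases st) auto
    have "B = U"
    proof (rule ccontr)
      assume "B \<noteq> U"
      then have "block_less U B" using True s st by auto
      moreover obtain u where "u \<in> U" using baseD(2)[OF b] st by fastforce
      ultimately have "u < i" using B(2) unfolding block_less_def by blast
      then show False using ge[OF \<open>u \<in> U\<close>] st by auto
    qed
    then show thesis
      using that(1)[of r] that(2)[of "B - {i}" r] st Bi by (cases "B - {i} = {}") auto
  next
    case False
    then have "B \<in> C" using B(1) by simp
    then have "C = insert B (C - {B})" by blast
    then show thesis
      using that(3)[of "C - {B}"] that(4)[of "B - {i}" "C - {B}"] Bi by (cases "B - {i} = {}") auto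
  qed
qed

lemma admissible_block:
  assumes "admissible col T X C st" "V \<in> C \<union> set st"
  shows "V \<noteq> {}" "V \<subseteq> X"
  using assms unfolding admissible_def base_def partition_on_def by blast+

text \<open>An admissible state is traced back by undoing the transition dictated by the block of
  its least letter. Alternation of T matters where a new block begins: the top of the stack then has
  another color, so \<open>nxt\<close> does take its second branch.\<close>

lemma states_admissible:
  assumes T: "\<And>s. s \<in> T \<Longrightarrow> distinct_adj s" and "sorted_wrt (<) is"
  shows "(C, st) \<in> states col T is \<longleftrightarrow> admissible col T (set is) C st"
  using assms(2)
proof (induction "is" arbitrary: C st)
  case Nil
  have "C = {} \<and> st = []" if "admissible col T {} C st"
  proof -
    have "\<Union>(C \<union> set st) = {}" "{} \<notin> C \<union> set st"
      using that unfolding admissible_def by (auto dest: baseD)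
    then show ?thesis by (cases st) auto
  qed
  moreover have "admissible col T {} {} []"
    by (auto simp: admissible_def intro!: baseI)
  ultimately show ?case by auto
next
  case (Cons i "is")
  have less: "i < x" if "x \<in> set is" for x using Cons.prems that by simp
  have IH: "(C, st) \<in> states col T is \<longleftrightarrow> admissible col T (set is) C st" for C st
    using Cons by simp
  have iblk: "i \<notin> V" "V \<noteq> {}" if "admissible col T (set is) C st" "V \<in> C \<union> set st" for C st V
    using admissible_block[OF that] less by blast+
  have ext: "admissible col T (insert i (set is)) C (insert i V # st) \<longleftrightarrow>
      admissible col T (set is) C (V # st) \<and> col (Max V) = col i" if "V \<noteq> {}" "i \<notin> V" for C V st
    by (rule admissible_extend[OF finite_set less that])
  have close: "admissible col T (insert i (set is)) (insert (insert i V) C) st \<longleftrightarrow>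
      admissible col T (set is) C (V # st) \<and> col (Max V) = col i"
    if "V \<noteq> {}" "i \<notin> V" "insert i V \<notin> C" for C V st
    by (rule admissible_close[OF finite_set less that])
  have opn: "admissible col T (insert i (set is)) C ({i} # st) \<longleftrightarrow>
      admissible col T (set is) C st \<and> col i # map (col \<circ> Max) st \<in> T" for C st
    by (rule admissible_open[OF finite_set less])
  have sing: "admissible col T (insert i (set is)) (insert {i} C) st \<longleftrightarrow>
      admissible col T (set is) C st \<and> col i # map (col \<circ> Max) st \<in> T" if "{i} \<notin> C" for C st
    by (rule admissible_singleton[OF finite_set less that])
  show ?case
  proof
    assume "(C, st) \<in> states col T (i # is)"
    then obtain C\<^sub>0 st\<^sub>0 where S: "admissible col T (set is) C\<^sub>0 st\<^sub>0" "(C, st) \<in> nxt col T i (C\<^sub>0, st\<^sub>0)"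
      using IH by auto
    show "admissible col T (set (i # is)) C st"
    proof (cases "st\<^sub>0 \<noteq> [] \<and> col (Max (hd st\<^sub>0)) = col i")
      case True
      then obtain V r where st0: "st\<^sub>0 = V # r" "col (Max V) = col i" by (cases st\<^sub>0) auto
      have V: "i \<notin> V" "V \<noteq> {}" using iblk[OF S(1), of V] st0(1) by simp_all
      have "insert i V \<notin> C\<^sub>0" using iblk(1)[OF S(1), of "insert i V"] by auto
      then show ?thesis
        using S ext[OF V(2,1), of C\<^sub>0 r] close[OF V(2,1), of C\<^sub>0 r] st0 by auto
    next
      case False
      have "{i} \<notin> C\<^sub>0" using iblk(1)[OF S(1), of "{i}"] by auto
      then show ?thesis
        using S opn[of C\<^sub>0 st\<^sub>0] sing[of C\<^sub>0 st\<^sub>0] False by (auto split: if_splits)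
    qed
  next
    assume A: "admissible col T (set (i # is)) C st"
    then have A': "admissible col T (insert i (set is)) C st" by simp
    have mem: "(C, st) \<in> states col T (i # is)"
      if "admissible col T (set is) C\<^sub>0 st\<^sub>0" "(C, st) \<in> nxt col T i (C\<^sub>0, st\<^sub>0)" for C\<^sub>0 st\<^sub>0
      using that IH unfolding states.simps by blast
    show "(C, st) \<in> states col T (i # is)"
    proof (rule block_of_least[OF A' less])
      fix r assume st: "st = {i} # r"
      then have R: "admissible col T (set is) C r" "col i # map (col \<circ> Max) r \<in> T"
        using A' opn by simp_all
      show ?thesis
        by (rule mem[OF R(1)]) (use st R(2) alternating_hd_color[OF T R(2)] in auto)
    next
      fix V r assume V: "st = insert i V # r" "V \<noteq> {}" "i \<notin> V"
      then have R: "admissible col T (set is) C (V # r)" "col (Max V) = col i"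
        using A' ext by simp_all
      show ?thesis by (rule mem[OF R(1)]) (use V R(2) in simp)
    next
      fix C' assume C': "C = insert {i} C'" "{i} \<notin> C'"
      then have R: "admissible col T (set is) C' st" "col i # map (col \<circ> Max) st \<in> T"
        using A' sing by simp_all
      show ?thesis
        by (rule mem[OF R(1)]) (use C' R(2) alternating_hd_color[OF T R(2)] in auto)
    next
      fix V C' assume V: "C = insert (insert i V) C'" "V \<noteq> {}" "i \<notin> V" "insert i V \<notin> C'"
      then have R: "admissible col T (set is) C' (V # st)" "col (Max V) = col i"
        using A' close by simp_all
      show ?thesis by (rule mem[OF R(1)]) (use V R(2) in simp)
    qed
  qed
qed

text \<open>The inverse of the transitions, which makes the sums over successors disjoint.\<close>

fun prv :: "nat \<Rightarrow> nat set set \<times> nat set list \<Rightarrow> nat set set \<times> nat set list" where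
  "prv i (C, st) = ({B\<in>C. i \<notin> B},
    if st \<noteq> [] \<and> i \<in> hd st then (if hd st = {i} then tl st else (hd st - {i}) # tl st)
    else if {i} \<in> C then st else (\<Union>{B\<in>C. i \<in> B} - {i}) # st)"

text \<open>In a successor exactly one block contains i; if it is closed, the union in
  \<open>prv\<close> returns precisely this block.\<close>

lemma prv_nxt:
  assumes "\<And>V. V \<in> C \<union> set st \<Longrightarrow> i \<notin> V \<and> V \<noteq> {}" "S \<in> nxt col T i (C, st)"
  shows "prv i S = (C, st)"
proof -
  have C: "{B\<in>C. i \<notin> B} = C" "{B\<in>C. i \<in> B} = {}" using assms(1) by blast+
  have C': "{B \<in> insert A C. i \<notin> B} = C" "{B \<in> insert A C. i \<in> B} = {A}" if "i \<in> A" for A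
    using that assms(1) by blast+
  have iC: "{i} \<notin> C" using assms(1) by blast
  have "st = [] \<or> i \<notin> hd st" using assms(1) by (cases st) auto
  then consider V r where "st = V # r" "V \<noteq> {}" "i \<notin> V" "S = (C, insert i V # r) \<or> S = (insert (insert i V) C, r)"
    | "S = (insert {i} C, st) \<or> S = (C, {i} # st)"
    using assms by (cases st) (auto split: if_splits)
  then show ?thesis
  proof cases
    case (1 V r)
    have V: "insert i V \<noteq> {i}" "insert i V - {i} = V" "{i} \<noteq> insert i V" using 1 by blast+
    have "\<not> (r \<noteq> [] \<and> i \<in> hd r)" using assms(1) 1(1) by (cases r) auto
    moreover have "{i} \<notin> insert (insert i V) C" using V(3) iC by blast
    ultimately have "prv i (insert (insert i V) C, r) = (C, V # r)"
      using V(2) C' by (simp only: prv.simps if_False) simp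
    moreover have "prv i (C, insert i V # r) = (C, V # r)"
      using V(1,2) C(1) by (simp only: prv.simps list.sel) simp
    ultimately have "prv i (C, insert i V # r) = (C, V # r)" "prv i (insert (insert i V) C, r) = (C, V # r)"
      by simp_all
    then show ?thesis using 1(1,4) by metis
  next
    case 2
    have "\<not> (st \<noteq> [] \<and> i \<in> hd st)" using \<open>st = [] \<or> i \<notin> hd st\<close> by blast
    then have "prv i (insert {i} C, st) = (C, st)"
      using C'(1)[of "{i}"] by (simp only: prv.simps if_False) simp
    moreover have "prv i (C, {i} # st) = (C, st)"
      using C(1) by (simp only: prv.simps list.sel) simp
    ultimately show ?thesis using 2 by metis
  qed
qed

lemma finite_nxt: "finite (nxt col T i S)"
  by (cases S) auto

lemma finite_states: "finite (states col T is)"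
  by (induction "is") (auto simp: finite_nxt)

lemma sum_states_Cons:
  fixes f :: "nat set set \<times> nat set list \<Rightarrow> 'a::comm_monoid_add"
  assumes T: "\<And>s. s \<in> T \<Longrightarrow> distinct_adj s" and "sorted_wrt (<) (i # is)"
  shows "(\<Sum>S\<in>states col T (i # is). f S) = (\<Sum>S\<in>states col T is. \<Sum>S'\<in>nxt col T i S. f S')"
  unfolding states.simps
proof (rule sum.UNION_disjoint)
  have prv: "prv i S' = S" if "S \<in> states col T is" "S' \<in> nxt col T i S" for S S'
  proof (cases S)
    case (Pair C st)
    then have "admissible col T (set is) C st"
      using that(1) states_admissible[OF T] assms(2) by auto
    then have "i \<notin> V \<and> V \<noteq> {}" if "V \<in> C \<union> set st" for V
      using admissible_block[OF _ that] assms(2) by fastforce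
    then show ?thesis using prv_nxt that(2) Pair by blast
  qed
  show "\<forall>S\<in>states col T is. \<forall>S'\<in>states col T is. S \<noteq> S' \<longrightarrow> nxt col T i S \<inter> nxt col T i S' = {}"
    using prv by (metis disjoint_iff)
qed (auto simp: finite_nxt finite_states)

section \<open>Chains of blocks and their maxima\<close>

lemma inj_on_Max_blocks:
  assumes "base col X P" "finite X"
  shows "inj_on Max P"
proof (rule inj_onI)
  fix V W assume VW: "V \<in> P" "W \<in> P" "Max V = Max W"
  then have "Max V \<in> V" "Max V \<in> W"
    using base_finite_block[OF assms] Max_in by metis+
  then show "V = W" using baseD(4)[OF assms(1)] VW by blast
qed

lemma nested_in_Max:
  assumes "nested_in V W" "finite V" "V \<noteq> {}" "finite W"
  shows "Max V < Max W"
proof -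
  obtain k where "k \<in> W" "\<forall>v\<in>V. v < k" using assms(1) unfolding nested_in_def by blast
  then have "Max V < k" using assms by simp
  then show ?thesis using Max_ge[OF assms(4) \<open>k \<in> W\<close>] by order
qed

text \<open>The blocks around V all straddle its points, so being non-crossing they are nested in
  each other, in the order of their maxima. Hence the chain is the sorted set of maxima pulled back
  along \<open>Max\<close>, and a block has the color of its maximum.\<close>

lemma chain_maxima:
  fixes X :: "'i::linorder set"
  assumes b: "base col X P" and fin: "finite X" and V: "V \<in> P"
  shows "map (block_color col) (chain P V) = map col (sorted_list_of_set (maxima P {} V))"
proof -
  define Q where "Q = insert V {W\<in>P. nested_in V W}"
  have Q: "Q \<subseteq> P" "finite Q"
    using V finite_UnionD[of P] fin baseD(1)[OF b] unfolding Q_def by auto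
  have blk: "finite W" "W \<noteq> {}" "Max W \<in> W" "Min W \<in> W" if "W \<in> P" for W
    using base_finite_block[OF b fin that] by auto
  have inj: "inj_on Max Q" using inj_on_Max_blocks[OF b fin] Q(1) inj_on_subset by blast
  define g where "g = the_inv_into Q Max"
  have g: "g (Max W) = W" if "W \<in> Q" for W
    unfolding g_def using the_inv_into_f_f[OF inj that] .
  let ?L = "sorted_list_of_set (Max ` Q)"
  have mx: "maxima P {} V = Max ` Q" by (simp add: maxima_def Q_def)
  have nest: "nested_in U W" if UW: "U \<in> Q" "W \<in> Q" "Max U < Max W" for U W
  proof -
    have P: "U \<in> P" "W \<in> P" using UW Q(1) by auto
    have "W \<noteq> V"
    proof
      assume "W = V"
      then have "nested_in V U" using UW unfolding Q_def by auto
      then have "Max V < Max U" using nested_in_Max blk[OF V] blk[OF P(1)] by blast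
      then show False using UW(3) \<open>W = V\<close> by simp
    qed
    then have VW: "nested_in V W" using UW(2) unfolding Q_def by simp
    show ?thesis
    proof (cases "U = V")
      case True
      then show ?thesis using VW by simp
    next
      case False
      then have VU: "nested_in V U" using UW(1) unfolding Q_def by simp
      obtain v where v: "v \<in> V" using blk[OF V] by blast
      obtain w where w: "w \<in> W" "w < v" using nested_in_greater[OF VW v] by blast
      have vU: "v < Max U"
        using nested_in_Max[OF VU] blk[OF V] blk[OF P(1)] Max_ge[OF blk(1)[OF V] v] by fastforce
      have ne: "Min U \<noteq> Min W"
        using baseD(4)[OF b P(1,2), of "Min U"] blk(4)[OF P(1)] blk(4)[OF P(2)] UW(3) by auto
      \<comment> \<open>Both blocks surround v, so Min W < v < Max U. With Min U < Min W and Max U <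
        Max W the four extrema would form a crossing.\<close>
      have "\<not> Min U < Min W"
      proof
        assume "Min U < Min W"
        moreover have "Min W < Max U"
          using Min_le[OF blk(1)[OF P(2)] w(1)] w(2) vU by order
        ultimately have "U = W"
          using noncrossingD[OF baseD(3)[OF b] P _ _ UW(3)] blk[OF P(1)] blk[OF P(2)] by blast
        then show False using UW(3) by simp
      qed
      then have "Min W < Min U" using ne by order
      then have "Min W < u \<and> u < Max W" if "u \<in> U" for u
        using that Min_le[OF blk(1)[OF P(1)] that] Max_ge[OF blk(1)[OF P(1)] that] UW(3) by (intro conjI) order+
      then show ?thesis unfolding nested_in_def using blk[OF P(2)] by blast
    qed
  qed
  have set_g: "set (map g ?L) = Q"
    using Q(2) g by (auto simp: image_image)
  have ch: "chain P V = map g ?L"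
    unfolding chain_def
  proof (rule the_equality)
    have "sorted_wrt (\<lambda>x y. nested_in (g x) (g y)) ?L"
      by (rule sorted_wrt_mono_rel[OF _ strict_sorted_list_of_set]) (use Q(2) g nest in auto)
    then show "set (map g ?L) = insert V {W \<in> P. nested_in V W} \<and> sorted_wrt nested_in (map g ?L)"
      using set_g by (simp add: sorted_wrt_map Q_def)
  next
    fix Vs assume Vs: "set Vs = insert V {W \<in> P. nested_in V W} \<and> sorted_wrt nested_in Vs"
    then have setQ: "set Vs = Q" by (simp add: Q_def)
    have "sorted_wrt (\<lambda>U W. Max U < Max W) Vs"
    proof (rule sorted_wrt_mono_rel)
      show "sorted_wrt nested_in Vs" using Vs by simp
      fix U W assume "U \<in> set Vs" "W \<in> set Vs" and n: "nested_in U W"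
      then have "U \<in> P" "W \<in> P" using setQ Q(1) by auto
      then show "Max U < Max W" using nested_in_Max[OF n] blk by metis
    qed
    then have "map Max Vs = ?L"
      using setQ Q(2) by (intro strict_sorted_equal) (auto simp: sorted_wrt_map)
    then have "map g ?L = map (g \<circ> Max) Vs" by (metis map_map)
    also have "\<dots> = Vs" using setQ g by (intro map_idI) simp
    finally show "Vs = map g ?L" by simp
  qed
  have bc: "block_color col W = col (Max W)" if "W \<in> Q" for W
  proof -
    have W: "W \<in> P" using that Q(1) by blast
    have "col ` W = {col (Max W)}"
      using baseD(5)[OF b W] blk(3)[OF W] by blast
    then show ?thesis by (simp add: block_color_def)
  qed
  have "block_color col (g x) = col x" if "x \<in> Max ` Q" for x
    using that g bc by auto
  then show ?thesis
    unfolding ch mx using Q(2) by simp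
qed

text \<open>With nothing open, the clauses on the stack are vacuous and \<open>maxima\<close>
  collects only V and the blocks enclosing it.\<close>

lemma NC_admissible:
  "C \<in> NC l col T \<longleftrightarrow> admissible col T {1..l} C []"
proof -
  have "C \<in> NC l col T \<longleftrightarrow> base col {1..l} C \<and> (\<forall>V\<in>C. map (block_color col) (chain C V) \<in> T)"
    unfolding NC_def noncrossing_partitions_def base_def noncrossing_def mem_Collect_eq
    by (simp only: conj_assoc)
  also have "\<dots> \<longleftrightarrow> admissible col T {1..l} C []"
    unfolding admissible_def using chain_maxima[of col "{1..l}" C] by auto
  finally show ?thesis .
qed

section \<open>Vectors of the free product carried by the machine\<close>

text \<open>An edge of the free tree adds or drops one first letter, so a path to the root can lose
  the letters of j # s only one by one and has to pass through s.\<close>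

lemma Tree_tl:
  assumes "T \<in> Tree N" "j # s \<in> T"
  shows "s \<in> T"
proof -
  obtain E where E: "E \<subseteq> free_tree_edges N" "\<forall>e\<in>E. e \<subseteq> T"
    and conn: "\<forall>s\<in>T. \<forall>t\<in>T. (s, t) \<in> {(u, v). {u, v} \<in> E}\<^sup>*" and "[] \<in> T"
    using assms(1) unfolding Tree_def by blast
  have "(j # s, []) \<in> {(u, v). {u, v} \<in> E}\<^sup>*" using conn assms(2) \<open>[] \<in> T\<close> by blast
  \<comment> \<open>The claim concerns all suffixes because the path may also move away from the
    root; such a step only enlarges the set of suffixes.\<close>
  then have "\<forall>u v. j # s = u @ v \<longrightarrow> v \<in> T"
  proof (induction rule: converse_rtrancl_induct)
    case base
    then show ?case using \<open>[] \<in> T\<close> by simp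
  next
    case (step x y)
    then have xy: "{x, y} \<in> E" by simp
    then have "x \<in> T" "{x, y} \<in> free_tree_edges N" using E by blast+
    then consider k where "x = k # y" | k where "y = k # x"
      unfolding free_tree_edges_def by (auto simp: doubleton_eq_iff)
    then show ?case
    proof cases
      case 1
      then show ?thesis using step.IH \<open>x \<in> T\<close> by (auto simp: Cons_eq_append_conv)
    next
      case 2
      then show ?thesis using step.IH by (metis append_Cons)
    qed
  qed
  then show ?thesis by (metis append_Cons append_Nil)
qed

text \<open>The tree enters through three properties: it contains the root, it is closed under
  dropping the first letter, and its strings alternate.\<close>

locale pointed_tree_product = T_free_product T Hs \<xi>s H \<xi> W \<tau>
  for T :: "nat list set"
    and Hs :: "nat \<Rightarrow> ('b::unital_cstar_algebra, 'h::ab_group_add) corr"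
    and \<xi>s :: "nat \<Rightarrow> 'h"
    and H :: "('b, 'k::ab_group_add) corr"
    and \<xi> :: 'k
    and W :: "nat list \<Rightarrow> 'k set"
    and \<tau> :: "nat \<Rightarrow> nat list \<Rightarrow> 'h \<Rightarrow> 'k \<Rightarrow> 'k" +
  fixes J :: "nat set"
  assumes nil_in_T: "[] \<in> T"
    and tl_in_T: "j # s \<in> T \<Longrightarrow> s \<in> T"
    and alternating: "s \<in> T \<Longrightarrow> distinct_adj s"
    and corrs: "j \<in> J \<Longrightarrow> correspondence (Hs j)"
    and unit_vectors: "j \<in> J \<Longrightarrow> central_unit_vector (Hs j) (\<xi>s j)"
begin

sublocale pointed_correspondence H \<xi>
  by unfold_locales (rule vacuum)

sublocale pointed_family J Hs \<xi>s
  by (rule pointed_family.intro, rule pointed_correspondence.intro)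
     (simp_all add: pointed_correspondence_axioms_def corrs unit_vectors)

lemma hd_color: "c # s \<in> T \<Longrightarrow> s = [] \<or> hd s \<noteq> c"
  using alternating[of "c # s"] by (cases s) auto

fun tens :: "(nat \<times> 'h) list \<times> 'b \<Rightarrow> 'k" where
  "tens ([], b) = ract H \<xi> b"
| "tens ((j, h) # st, b) = \<tau> j (map fst st) h (tens (st, b))"

text \<open>The carrier of \<open>centered\<close> is given by the inner product with \<xi> on the
  right, the machine keeps \<xi> on the left; the involution exchanges the two.\<close>

lemma centered_closed:
  assumes "j \<in> J" "h \<in> carr (Hs j)" "ip (Hs j) (\<xi>s j) h = 0"
  shows "h \<in> carr (centered (Hs j) (\<xi>s j))"
proof -
  interpret P: pointed_correspondence "Hs j" "\<xi>s j" by (rule pointed[OF assms(1)])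
  show ?thesis
    using assms P.ip_star[OF P.xi_closed assms(2)] by (simp add: centered_def star_zero)
qed

lemma tens_in_summand:
  assumes "wf_stack st" "map fst st \<in> T"
  shows "tens (st, b) \<in> W (map fst st)"
  using assms
proof (induction st)
  case Nil
  then show ?case by (simp add: summand_Nil)
next
  case (Cons p st)
  obtain j h where p: "p = (j, h)" by (cases p)
  then have js: "j # map fst st \<in> T" using Cons.prems(2) by simp
  interpret I: interior_tensor "centered (Hs j) (\<xi>s j)" "H\<lparr>carr := W (map fst st)\<rparr>"
    "H\<lparr>carr := W (j # map fst st)\<rparr>" "\<tau> j (map fst st)"
    by (rule summand_Cons[OF js])
  have "h \<in> carr (centered (Hs j) (\<xi>s j))"
    using Cons.prems(1) unfolding p wf_stack_Cons by (intro centered_closed) auto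
  moreover have "tens (st, b) \<in> W (map fst st)"
    using Cons.prems(1) p wf_stack_Cons tl_in_T[OF js] by (intro Cons.IH) auto
  ultimately show ?case
    using I.tensor_closed[of h "tens (st, b)"] by (simp add: p)
qed

lemma tens_closed: "wf_stack st \<Longrightarrow> map fst st \<in> T \<Longrightarrow> tens (st, b) \<in> carr H"
  using tens_in_summand summand_subset by blast

lemma tens_smul:
  assumes "wf_stack (fst S)" "map fst (fst S) \<in> T"
  shows "tens (smul c S) = lact H c (tens S)"
  using assms
proof (induction c S rule: smul.induct)
  case (1 c b)
  then show ?case
    by (simp add: ract_mult xi_closed lact_xi modular_ract[OF modular_lact])
next
  case (2 c j h st b)
  then have js: "j # map fst st \<in> T" by simp
  interpret I: interior_tensor "centered (Hs j) (\<xi>s j)" "H\<lparr>carr := W (map fst st)\<rparr>"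
    "H\<lparr>carr := W (j # map fst st)\<rparr>" "\<tau> j (map fst st)"
    by (rule summand_Cons[OF js])
  have "h \<in> carr (centered (Hs j) (\<xi>s j))"
    using 2(1) by (intro centered_closed) (auto simp: wf_stack_Cons)
  moreover have "tens (st, b) \<in> W (map fst st)"
    using 2(1) tl_in_T[OF js] by (intro tens_in_summand) (auto simp: wf_stack_Cons)
  ultimately show ?case
    using I.tensor_lact[of h "tens (st, b)" c] by (simp add: centered_def)
qed

text \<open>The two summands of \<open>tensor_split\<close> are the two outcomes of a step: the
  vacuum component acts on the remaining tensor, the centered component stays as a leg.\<close>

lemma tens_finish:
  assumes "wf_stack st" "map fst st \<in> T"
  shows "tensor_split (Hs c) (\<xi>s c) H (\<tau> c (map fst st)) y (tens (st, b)) =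
    tens (finish True c y (st, b)) + tens (finish False c y (st, b))"
  using assms by (simp add: tensor_split_def finish_def tens_smul centre_def)

lemma lact_zero: "w \<in> carr H \<Longrightarrow> lact H 0 w = 0"
  using lact_add[of w 0 0] by simp

lemma tensor_split_centered:
  assumes "c # s \<in> T" "c \<in> J" "w \<in> W s" "ip (Hs c) (\<xi>s c) h = 0"
  shows "tensor_split (Hs c) (\<xi>s c) H (\<tau> c s) h w = \<tau> c s h w"
proof -
  interpret P: pointed_correspondence "Hs c" "\<xi>s c" by (rule pointed[OF assms(2)])
  have "w \<in> carr H" using assms(3) summand_subset[OF tl_in_T[OF assms(1)]] by blast
  then show ?thesis
    using P.centre_eq[OF assms(4)] by (simp add: tensor_split_def assms(4) lact_zero centre_def)
qed

text \<open>This rewrites a vector w as a vacuum leg tensored with w, the form in which \<lambda> is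
  prescribed. The fresh vacuum of a newly opened block comes from here.\<close>

lemma tensor_split_xi:
  assumes "c # s \<in> T" "c \<in> J" "w \<in> W s"
  shows "tensor_split (Hs c) (\<xi>s c) H (\<tau> c s) (\<xi>s c) w = w"
proof -
  interpret P: pointed_correspondence "Hs c" "\<xi>s c" by (rule pointed[OF assms(2)])
  interpret I: interior_tensor "centered (Hs c) (\<xi>s c)" "H\<lparr>carr := W s\<rparr>" "H\<lparr>carr := W (c # s)\<rparr>" "\<tau> c s"
    by (rule summand_Cons[OF assms(1)])
  have w: "w \<in> carr H" using assms(3) summand_subset[OF tl_in_T[OF assms(1)]] by blast
  have "\<tau> c s 0 w = 0"
    using I.tensor_add_left[of 0 0 w] I.X.zero_closed assms(3) by simp
  then show ?thesis
    using w P.centre_xi by (simp add: tensor_split_def P.ip_xi_xi lact_one centre_def)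
qed

context
  fixes c :: nat and x :: "'h \<Rightarrow> 'h" and L :: "'k \<Rightarrow> 'k"
  assumes c: "c \<in> J" and lambda: "is_lambda T Hs \<xi>s H W \<tau> c x L"
begin

lemma lambda_zero:
  assumes "wf_stack st" "map fst st \<in> T" "st = [] \<or> fst (hd st) \<noteq> c" "c # map fst st \<notin> T"
  shows "L (tens (st, b)) = 0"
proof -
  have "map fst st = [] \<or> hd (map fst st) \<noteq> c" using assms(3) by (cases st) auto
  then show ?thesis
    using lambda tens_in_summand[OF assms(1,2), of b] assms(2,4) unfolding is_lambda_def by auto
qed

lemma lambda_split:
  assumes "c # s \<in> T" "h \<in> carr (Hs c)" "w \<in> W s"
  shows "L (tensor_split (Hs c) (\<xi>s c) H (\<tau> c s) h w) = tensor_split (Hs c) (\<xi>s c) H (\<tau> c s) (x h) w"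
  using lambda tl_in_T[OF assms(1)] hd_color[OF assms(1)] assms unfolding is_lambda_def by auto

lemma lambda_new:
  assumes "wf_stack st" "c # map fst st \<in> T"
  shows "L (tens (st, b)) = tens (finish True c (x (\<xi>s c)) (st, b)) + tens (finish False c (x (\<xi>s c)) (st, b))"
proof -
  have w: "tens (st, b) \<in> W (map fst st)"
    using assms tl_in_T by (intro tens_in_summand)
  have "L (tens (st, b)) = L (tensor_split (Hs c) (\<xi>s c) H (\<tau> c (map fst st)) (\<xi>s c) (tens (st, b)))"
    by (simp add: tensor_split_xi[OF assms(2) c w])
  also have "\<dots> = tensor_split (Hs c) (\<xi>s c) H (\<tau> c (map fst st)) (x (\<xi>s c)) (tens (st, b))"
    by (rule lambda_split[OF assms(2) xi_in[OF c] w])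
  finally show ?thesis
    using tens_finish assms tl_in_T by simp
qed

lemma lambda_continue:
  assumes "wf_stack ((c, h) # st)" "c # map fst st \<in> T"
  shows "L (tens ((c, h) # st, b)) = tens (finish True c (x h) (st, b)) + tens (finish False c (x h) (st, b))"
proof -
  have st: "wf_stack st" "h \<in> carr (Hs c)" "ip (Hs c) (\<xi>s c) h = 0"
    using assms(1) by (simp_all add: wf_stack_Cons)
  have w: "tens (st, b) \<in> W (map fst st)"
    using assms st tl_in_T by (intro tens_in_summand)
  have "L (tens ((c, h) # st, b)) = L (tensor_split (Hs c) (\<xi>s c) H (\<tau> c (map fst st)) h (tens (st, b)))"
    by (simp add: tensor_split_centered[OF assms(2) c w st(3)])
  also have "\<dots> = tensor_split (Hs c) (\<xi>s c) H (\<tau> c (map fst st)) (x h) (tens (st, b))"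
    by (rule lambda_split[OF assms(2) st(2) w])
  finally show ?thesis
    using tens_finish st assms tl_in_T by simp
qed

end

end

section \<open>Summation over states\<close>

fun new_set :: "nat set set \<times> nat set list \<Rightarrow> nat set" where
  "new_set (C, st) = Max ` (C \<union> set st)"

text \<open>An open block has already shown its maximum but not its minimum, so the stack
  contributes to \<open>new_set\<close> and not here. With an empty stack both are the flags used in
  \<open>run_blocks\<close>.\<close>

fun fin_set :: "nat set set \<times> nat set list \<Rightarrow> nat set" where
  "fin_set (C, st) = Min ` C"

declare new_set.simps [simp del] fin_set.simps [simp del]

lemma flags_notin:
  assumes "\<And>V. V \<in> C \<union> set st \<Longrightarrow> finite V \<and> V \<noteq> {} \<and> i \<notin> V"
  shows "i \<notin> new_set (C, st)" "i \<notin> fin_set (C, st)"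
proof -
  have "Max V \<in> V" "Min V \<in> V" "i \<notin> V" if "V \<in> C \<union> set st" for V
    using assms[OF that] by simp_all
  then show "i \<notin> new_set (C, st)" "i \<notin> fin_set (C, st)"
    unfolding new_set.simps fin_set.simps by blast+
qed

lemma flags_singleton:
  "new_set (insert {i} C, st) = insert i (new_set (C, st))"
  "fin_set (insert {i} C, st) = insert i (fin_set (C, st))"
  "new_set (C, {i} # st) = insert i (new_set (C, st))"
  "fin_set (C, {i} # st) = fin_set (C, st)"
  by (auto simp: new_set.simps fin_set.simps)

lemma flags_insert:
  assumes "finite V" "V \<noteq> {}" "\<And>v. v \<in> V \<Longrightarrow> i < v"
  shows "new_set (C, insert i V # st) = new_set (C, V # st)"
    "fin_set (C, insert i V # st) = fin_set (C, V # st)"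
    "new_set (insert (insert i V) C, st) = new_set (C, V # st)"
    "fin_set (insert (insert i V) C, st) = insert i (fin_set (C, V # st))"
proof -
  have "i < Max V" "i < Min V" using assms Max_in Min_in by blast+
  then have "Max (insert i V) = Max V" "Min (insert i V) = i"
    using assms(1,2) by (simp_all add: max_absorb2 min_absorb1)
  then show "new_set (C, insert i V # st) = new_set (C, V # st)"
    "fin_set (C, insert i V # st) = fin_set (C, V # st)"
    "new_set (insert (insert i V) C, st) = new_set (C, V # st)"
    "fin_set (insert (insert i V) C, st) = insert i (fin_set (C, V # st))"
    by (simp_all add: new_set.simps fin_set.simps)
qed

context pointed_tree_product
begin

abbreviation run_state :: "(nat \<Rightarrow> nat) \<Rightarrow> (nat \<Rightarrow> 'h \<Rightarrow> 'h) \<Rightarrow> nat list \<Rightarrow> nat set set \<times> nat set list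
    \<Rightarrow> ((nat \<times> 'h) list \<times> 'b) option" where
  "run_state col a is S \<equiv> run col (new_set S) (fin_set S) a ([], 1) is"

text \<open>The vectors on the machine's stack mirror the open blocks color by color; membership of
  the string in T places the tensor in a summand of the free product.\<close>

definition valid_run :: "(nat \<Rightarrow> nat) \<Rightarrow> (nat \<Rightarrow> 'h \<Rightarrow> 'h) \<Rightarrow> nat list \<Rightarrow> nat set set \<times> nat set list \<Rightarrow> bool" where
  "valid_run col a is S \<longleftrightarrow> (\<exists>vs b. run_state col a is S = Some (vs, b) \<and>
     map fst vs = map (col \<circ> Max) (snd S) \<and> wf_stack vs \<and> map fst vs \<in> T)"

lemma map_fst_smul: "map fst (fst (smul c S)) = map fst (fst S)"
  by (induction c S rule: smul.induct) auto

lemma map_fst_finish: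
  "map fst (fst (finish fin c y S)) = (if fin then map fst (fst S) else c # map fst (fst S))"
  by (simp add: finish_def map_fst_smul)

text \<open>The branches of \<open>nxt\<close> are the cases in the prescription of \<lambda>: a top
  leg of the same color, a fresh vacuum leg, or zero. In the first two, leaving the block open and
  closing it are the two summands of the split tensor.\<close>

lemma nxt_step:
  assumes i: "i \<notin> set is" "col i \<in> J" "modular (Hs (col i)) (a i)"
    and L: "is_lambda T Hs \<xi>s H W \<tau> (col i) (a i) L"
    and adm: "admissible col T (set is) C st" and less: "\<And>j. j \<in> set is \<Longrightarrow> i < j"
    and run: "run_state col a is (C, st) = Some (vs, b)" "map fst vs = map (col \<circ> Max) st"
      "wf_stack vs" "map fst vs \<in> T"
  shows "(\<forall>S\<in>nxt col T i (C, st). valid_run col a (i # is) S) \<and>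
    L (tens (vs, b)) = (\<Sum>S\<in>nxt col T i (C, st). tens (the (run_state col a (i # is) S)))"
proof -
  let ?c = "col i"
  have blk: "finite V" "V \<noteq> {}" "i \<notin> V" "\<And>v. v \<in> V \<Longrightarrow> i < v" if "V \<in> C \<union> set st" for V
    using admissible_block[OF adm that] less finite_subset[of V "set is"] by blast+
  have notin: "i \<notin> new_set (C, st)" "i \<notin> fin_set (C, st)"
    using blk(1-3) by (intro flags_notin; blast)+
  \<comment> \<open>Passing to a successor changes the flags at i only, and i is not among the
    letters read so far.\<close>
  have run': "run col M F a ([], 1) is = Some (vs, b)"
    if "M = new_set (C, st) \<or> M = insert i (new_set (C, st))"
      "F = fin_set (C, st) \<or> F = insert i (fin_set (C, st))" for M F
  proof -
    have "run col M F a ([], 1) is = run_state col a is (C, st)"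
      by (rule run_cong) (use that i(1) in auto)
    then show ?thesis using run(1) by simp
  qed
  have wf: "wf_stack (fst (finish fin ?c y S))" if "y \<in> carr (Hs ?c)" "wf_stack (fst S)" for fin y S
    by (rule wf_finish[OF i(2) that])
  show ?thesis
  proof (cases "st \<noteq> [] \<and> col (Max (hd st)) = ?c")
    case True
    then obtain V r where st: "st = V # r" "col (Max V) = ?c" by (cases st) auto
    then obtain h vr where vs: "vs = (?c, h) # vr" "map fst vr = map (col \<circ> Max) r"
      using run(2) by (cases vs) auto
    have V: "finite V" "V \<noteq> {}" "\<And>v. v \<in> V \<Longrightarrow> i < v" "i \<notin> V"
      using blk[of V] st(1) by auto
    have wfh: "wf_stack vr" "a i h \<in> carr (Hs ?c)"
      using run(3) modular_closed[OF i(3)] unfolding vs(1) wf_stack_Cons by auto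
    have T: "?c # map fst vr \<in> T" using run(4) vs(1) by simp
    have fl: "new_set (C, insert i V # r) = new_set (C, st)"
      "fin_set (C, insert i V # r) = fin_set (C, st)"
      "new_set (insert (insert i V) C, r) = new_set (C, st)"
      "fin_set (insert (insert i V) C, r) = insert i (fin_set (C, st))"
      unfolding st(1) by (intro flags_insert V; assumption)+
    have m: "run_state col a (i # is) (C, insert i V # r) = Some (finish False ?c (a i h) (vr, b))"
      "run_state col a (i # is) (insert (insert i V) C, r) = Some (finish True ?c (a i h) (vr, b))"
      unfolding run.simps fl using notin run' vs(1) by simp_all
    have nx: "nxt col T i (C, st) = {(C, insert i V # r), (insert (insert i V) C, r)}"
      using st by simp
    have "i < Max V" using V(1-3) by simp
    then have "col (Max (insert i V)) = ?c" using V(1,2) st(2) by (simp add: max_absorb2)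
    then have "valid_run col a (i # is) (C, insert i V # r)"
      unfolding valid_run_def m using wf[OF wfh(2), of "(vr, b)" False] wfh(1) T vs(2)
      by (cases "finish False ?c (a i h) (vr, b)") (use map_fst_finish[of False ?c "a i h" "(vr, b)"] in auto)
    moreover have "valid_run col a (i # is) (insert (insert i V) C, r)"
      unfolding valid_run_def m using wf[OF wfh(2), of "(vr, b)" True] wfh(1) tl_in_T[OF T] vs(2)
      by (cases "finish True ?c (a i h) (vr, b)") (use map_fst_finish[of True ?c "a i h" "(vr, b)"] in auto)
    moreover have "L (tens (vs, b)) = tens (finish True ?c (a i h) (vr, b)) + tens (finish False ?c (a i h) (vr, b))"
      unfolding vs(1) by (rule lambda_continue[OF i(2) L]) (use run(3) vs(1) T in auto)
    ultimately show ?thesis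
      unfolding nx by (simp add: m add.commute del: run.simps)
  next
    case False
    then have F: "st = [] \<or> col (Max (hd st)) \<noteq> ?c" by blast
    have w: "?c # map (col \<circ> Max) st = ?c # map fst vs" using run(2) by simp
    show ?thesis
    proof (cases "?c # map fst vs \<in> T")
      case T: True
      have m: "run_state col a (i # is) (C, {i} # st) = Some (finish False ?c (a i (\<xi>s ?c)) (vs, b))"
        "run_state col a (i # is) (insert {i} C, st) = Some (finish True ?c (a i (\<xi>s ?c)) (vs, b))"
        unfolding run.simps flags_singleton using notin run' by simp_all
      have y: "a i (\<xi>s ?c) \<in> carr (Hs ?c)"
        using modular_closed[OF i(3)] xi_in[OF i(2)] by blast
      have nx: "nxt col T i (C, st) = {(insert {i} C, st), (C, {i} # st)}"
        using False T w by (simp only: nxt.simps if_False if_True)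
      have "valid_run col a (i # is) (C, {i} # st)"
        unfolding valid_run_def m using wf[OF y, of "(vs, b)" False] run(2,3) T
        by (cases "finish False ?c (a i (\<xi>s ?c)) (vs, b)") (use map_fst_finish[of False ?c "a i (\<xi>s ?c)" "(vs, b)"] in auto)
      moreover have "valid_run col a (i # is) (insert {i} C, st)"
        unfolding valid_run_def m using wf[OF y, of "(vs, b)" True] run(2-4)
        by (cases "finish True ?c (a i (\<xi>s ?c)) (vs, b)") (use map_fst_finish[of True ?c "a i (\<xi>s ?c)" "(vs, b)"] in auto)
      moreover note lambda_new[OF i(2) L run(3) T, of b]
      ultimately show ?thesis
        unfolding nx by (simp add: m del: run.simps)
    next
      \<comment> \<open>The string is missing from T: there is no successor, and \<lambda> kills the
        vector, so both sides are 0.\<close>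
      case nT: False
      have "vs = [] \<or> fst (hd vs) \<noteq> ?c"
        using F run(2) by (cases vs; cases st) auto
      then have "L (tens (vs, b)) = 0"
        using lambda_zero[OF i(2) L run(3,4) _ nT] by blast
      moreover have "nxt col T i (C, st) = {}"
        using False nT w by (simp only: nxt.simps if_False)
      ultimately show ?thesis by simp
    qed
  qed
qed

text \<open>Applying the next operator replaces each term by the terms of its successor states.
  Distinct states have no common successor, so no term of the new sum is counted twice.\<close>

lemma foldr_lambda:
  assumes "sorted_wrt (<) is"
    and "\<And>i. i \<in> set is \<Longrightarrow> col i \<in> J \<and> modular (Hs (col i)) (a i) \<and>
      is_lambda T Hs \<xi>s H W \<tau> (col i) (a i) (L i)"
  shows "(\<forall>S\<in>states col T is. valid_run col a is S) \<and>
    foldr (\<circ>) (map L is) id \<xi> = (\<Sum>S\<in>states col T is. tens (the (run_state col a is S)))"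
  using assms
proof (induction "is")
  case Nil
  then show ?case
    using nil_in_T by (simp add: valid_run_def wf_stack_Nil ract_one xi_closed)
next
  case (Cons i "is")
  have i: "col i \<in> J" "modular (Hs (col i)) (a i)" and
    Li: "is_lambda T Hs \<xi>s H W \<tau> (col i) (a i) (L i)"
    using Cons.prems(2)[of i] by auto
  have less: "i < j" if "j \<in> set is" for j using Cons.prems(1) that by simp
  then have notin: "i \<notin> set is" by blast
  have sorted_is: "sorted_wrt (<) is" using Cons.prems(1) by simp
  have "(\<forall>S\<in>states col T is. valid_run col a is S) \<and>
    foldr (\<circ>) (map L is) id \<xi> = (\<Sum>S\<in>states col T is. tens (the (run_state col a is S)))"
    by (rule Cons.IH[OF sorted_is Cons.prems(2)]) simp
  then have IH: "\<forall>S\<in>states col T is. valid_run col a is S"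
    "foldr (\<circ>) (map L is) id \<xi> = (\<Sum>S\<in>states col T is. tens (the (run_state col a is S)))"
    by blast+
  have step: "(\<forall>S'\<in>nxt col T i S. valid_run col a (i # is) S') \<and>
    L i (tens (the (run_state col a is S))) = (\<Sum>S'\<in>nxt col T i S. tens (the (run_state col a (i # is) S')))"
    and closed: "tens (the (run_state col a is S)) \<in> carr H"
    if S: "S \<in> states col T is" for S
  proof -
    obtain C st where Cst: "S = (C, st)" by (cases S)
    have "admissible col T (set is) C st"
      using S states_admissible[OF alternating sorted_is] unfolding Cst by simp
    moreover obtain vs b where vs: "run_state col a is (C, st) = Some (vs, b)"
      "map fst vs = map (col \<circ> Max) st" "wf_stack vs" "map fst vs \<in> T"
      using IH(1) S unfolding valid_run_def Cst by fastforce
    ultimately show "(\<forall>S'\<in>nxt col T i S. valid_run col a (i # is) S') \<and>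
      L i (tens (the (run_state col a is S))) = (\<Sum>S'\<in>nxt col T i S. tens (the (run_state col a (i # is) S')))"
      using nxt_step[OF notin i Li _ less vs] unfolding Cst vs(1) by simp
    show "tens (the (run_state col a is S)) \<in> carr H"
      unfolding Cst vs(1) using tens_closed vs(3,4) by simp
  qed
  have "modular H (L i)"
    using Li adjointable_modular unfolding is_lambda_def by blast
  then have "foldr (\<circ>) (map L (i # is)) id \<xi> = (\<Sum>S\<in>states col T is. L i (tens (the (run_state col a is S))))"
    using IH(2) closed by (simp add: modular_sum)
  also have "\<dots> = (\<Sum>S\<in>states col T is. \<Sum>S'\<in>nxt col T i S. tens (the (run_state col a (i # is) S')))"
    by (intro sum.cong refl) (use step in blast)
  also have "\<dots> = (\<Sum>S\<in>states col T (i # is). tens (the (run_state col a (i # is) S)))"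
    by (rule sum_states_Cons[OF alternating Cons.prems(1), symmetric])
  finally have "foldr (\<circ>) (map L (i # is)) id \<xi> =
      (\<Sum>S\<in>states col T (i # is). tens (the (run_state col a (i # is) S)))" .
  moreover have "\<forall>S\<in>states col T (i # is). valid_run col a (i # is) S"
    unfolding states.simps using step(1) by blast
  ultimately show ?case by blast
qed

text \<open>A nonempty stack places the tensor in a summand orthogonal to the one containing \<xi>,
  so only states without open blocks survive the pairing.\<close>

lemma ip_xi_tens:
  assumes "wf_stack vs" "map fst vs \<in> T"
  shows "ip H \<xi> (tens (vs, b)) = (if vs = [] then b else 0)"
proof (cases "vs = []")
  case True
  then show ?thesis by (simp add: ip_ract_right xi_closed ip_xi_xi)
next
  case False
  have "\<xi> \<in> W []"
    unfolding summand_Nil using ract_one[OF xi_closed] by (metis rangeI)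
  then show ?thesis
    using False summand_orthogonal[OF nil_in_T assms(2) _ _ tens_in_summand[OF assms]] by simp
qed

lemma moment_formula:
  assumes "\<And>i. i \<in> {1..l} \<Longrightarrow> col i \<in> J \<and> modular (Hs (col i)) (a i) \<and>
      is_lambda T Hs \<xi>s H W \<tau> (col i) (a i) (L i)"
  shows "ip H \<xi> (foldr (\<circ>) (map L [1..<Suc l]) id \<xi>) = (\<Sum>\<pi>\<in>NC l col T. Lambda Hs \<xi>s col \<pi> a)"
proof -
  let ?is = "[1..<Suc l]"
  let ?S = "states col T ?is"
  have set_is: "set ?is = {1..l}" by auto
  have "(\<forall>S\<in>?S. valid_run col a ?is S) \<and>
      foldr (\<circ>) (map L ?is) id \<xi> = (\<Sum>S\<in>?S. tens (the (run_state col a ?is S)))"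
    by (rule foldr_lambda[OF sorted_wrt_upt]) (use assms set_is in blast)
  then have fold: "\<forall>S\<in>?S. valid_run col a ?is S"
    "foldr (\<circ>) (map L ?is) id \<xi> = (\<Sum>S\<in>?S. tens (the (run_state col a ?is S)))"
    by blast+
  have ip: "ip H \<xi> (tens (the (run_state col a ?is S))) =
      (if snd S = [] then snd (the (run_state col a ?is S)) else 0)"
    and closed: "tens (the (run_state col a ?is S)) \<in> carr H" if S: "S \<in> ?S" for S
  proof -
    obtain vs b where vs: "run_state col a ?is S = Some (vs, b)"
      "map fst vs = map (col \<circ> Max) (snd S)" "wf_stack vs" "map fst vs \<in> T"
      using fold(1) S unfolding valid_run_def by blast
    have "vs = [] \<longleftrightarrow> snd S = []" using vs(2) by (metis list.map_disc_iff)
    then show "ip H \<xi> (tens (the (run_state col a ?is S))) =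
      (if snd S = [] then snd (the (run_state col a ?is S)) else 0)"
      unfolding vs(1) using ip_xi_tens[OF vs(3,4), of b] by simp
    show "tens (the (run_state col a ?is S)) \<in> carr H"
      unfolding vs(1) using tens_closed[OF vs(3,4)] by simp
  qed
  have "ip H \<xi> (foldr (\<circ>) (map L ?is) id \<xi>) = (\<Sum>S\<in>?S. ip H \<xi> (tens (the (run_state col a ?is S))))"
    unfolding fold(2) by (rule ip_sum_right[OF xi_closed closed])
  also have "\<dots> = (\<Sum>S\<in>?S. if snd S = [] then snd (the (run_state col a ?is S)) else 0)"
    by (intro sum.cong refl ip)
  also have "\<dots> = (\<Sum>S\<in>{S \<in> ?S. snd S = []}. snd (the (run_state col a ?is S)))"
    by (rule sum.inter_filter[symmetric, OF finite_states])
  also have "{S \<in> ?S. snd S = []} = (\<lambda>\<pi>. (\<pi>, [])) ` NC l col T"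
  proof -
    have "(\<pi>, []) \<in> ?S \<longleftrightarrow> \<pi> \<in> NC l col T" for \<pi>
      unfolding NC_admissible set_is[symmetric]
      by (rule states_admissible[OF alternating]) (auto simp only: sorted_wrt_upt)
    then show ?thesis by (auto simp del: upt_Suc)
  qed
  also have "(\<Sum>S\<in>(\<lambda>\<pi>. (\<pi>, [])) ` NC l col T. snd (the (run_state col a ?is S))) =
      (\<Sum>\<pi>\<in>NC l col T. snd (the (run_state col a ?is (\<pi>, []))))"
    by (subst sum.reindex) (simp_all add: inj_on_def del: upt_Suc)
  also have "\<dots> = (\<Sum>\<pi>\<in>NC l col T. Lambda Hs \<xi>s col \<pi> a)"
  proof (intro sum.cong refl)
    \<comment> \<open>With nothing open, \<open>new_set\<close> and \<open>fin_set\<close> are the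
      maxima and the minima of the blocks of \<pi>, so this is the run evaluated in
      \<open>run_Lambda\<close>.\<close>
    fix \<pi> assume "\<pi> \<in> NC l col T"
    from run_Lambda[OF this, of a] assms
    show "snd (the (run_state col a ?is (\<pi>, []))) = Lambda Hs \<xi>s col \<pi> a"
      by (simp add: new_set.simps fin_set.simps del: upt_Suc)
  qed
  finally show ?thesis .
qed

end

theorem theorem4p21:
  fixes N l :: nat
    and T :: "nat list set"
    and Hs :: "nat \<Rightarrow> ('b::unital_cstar_algebra, 'h::ab_group_add) corr"
    and \<xi>s :: "nat \<Rightarrow> 'h"
    and H :: "('b, 'k::ab_group_add) corr"
    and \<xi> :: 'k
    and W :: "nat list \<Rightarrow> 'k set"
    and \<tau> :: "nat \<Rightarrow> nat list \<Rightarrow> 'h \<Rightarrow> 'k \<Rightarrow> 'k"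
    and lam :: "nat \<Rightarrow> ('h \<Rightarrow> 'h) \<Rightarrow> 'k \<Rightarrow> 'k"
    and col :: "nat \<Rightarrow> nat"
    and a :: "nat \<Rightarrow> 'h \<Rightarrow> 'h"
  assumes "T \<in> Tree N"
    and "\<And>j. j \<in> {1..N} \<Longrightarrow> correspondence (Hs j)"
    and "\<And>j. j \<in> {1..N} \<Longrightarrow> central_unit_vector (Hs j) (\<xi>s j)"
    and "T_free_product T Hs \<xi>s H \<xi> W \<tau>"
    and "\<And>j x. \<lbrakk>j \<in> {1..N}; x \<in> adjointable (Hs j)\<rbrakk> \<Longrightarrow> is_lambda T Hs \<xi>s H W \<tau> j x (lam j x)"
    and "\<And>i. i \<in> {1..l} \<Longrightarrow> col i \<in> {1..N}"
    and "\<And>i. i \<in> {1..l} \<Longrightarrow> a i \<in> adjointable (Hs (col i))"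
  shows "ip H \<xi> (foldr (\<circ>) (map (\<lambda>i. lam (col i) (a i)) [1..<Suc l]) id \<xi>)
           = (\<Sum>\<pi> \<in> NC l col T. Lambda Hs \<xi>s col \<pi> a)"
proof -
  interpret T_free_product T Hs \<xi>s H \<xi> W \<tau> by fact
  have "T \<subseteq> free_tree_vertices N" "[] \<in> T"
    using assms(1) by (simp_all add: Tree_def)
  \<comment> \<open>Alternation is inherited from the free tree, closure under dropping the first
    letter comes from connectedness.\<close>
  then interpret pointed_tree_product T Hs \<xi>s H \<xi> W \<tau> "{1..N}"
    using Tree_tl[OF assms(1)] assms(2,3)
    by (intro pointed_tree_product.intro pointed_tree_product_axioms.intro T_free_product_axioms)
       (auto simp only: free_tree_vertices_def)
  show ?thesis
    by (rule moment_formula) (use assms(5-7) adjointable_modular in blast)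
qed

end
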